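(* For every $n\ge2$, $\mu(S_3^n)=3^{n-2}+3$. Moreover, for $n\ge4$: if $X$ is a mutual-visibility set of $S_3^n$ with $|X|=3^{n-2}+3$, then $|X\cap V(iS_3^{n-1})|=3^{n-3}+1$ for every $i\in\{0,1,2\}$; and for every mutual-visibility set $X$ of $S_3^n$ and all distinct $i,j\in\{0,1,2\}$, $|X\cap(V(iS_3^{n-1})\cup V(jS_3^{n-1}))|\le 2\cdot3^{n-3}+4$.
   Context: For $p\ge3$, $n\ge1$, the Sierpiński graph $S_p^n$ has vertex set $\{0,1,\dots,p-1\}^n$, a vertex written $i_1\cdots i_n$; vertices $i_1\cdots i_n$ and $j_1\cdots j_n$ are adjacent iff there is $h$ with $i_t=j_t$ for $t<h$, $i_h\ne j_h$, and $i_t=j_h$, $j_t=i_h$ for $t>h$. For $i\in\{0,\dots,p-1\}$, $iS_p^{n-1}$ denotes the subgraph of $S_p^n$ induced by all vertices whose first coordinate is $i$. For $X\subseteq V(G)$, $u,v$ are $X$-visible if some shortest $u,v$-path $P$ has $V(P)\cap X\subseteq\{u,v\}$; $X$ is a mutual-visibility set if every two vertices of $X$ are $X$-visible; $\mu(G)$ is the maximum size of a mutual-visibility set. *)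

theory Defs
  imports Main
begin

definition is_walk :: "'a set \<Rightarrow> ('a \<Rightarrow> 'a \<Rightarrow> bool) \<Rightarrow> 'a list \<Rightarrow> bool" where
  "is_walk V E P \<longleftrightarrow> P \<noteq> [] \<and> set P \<subseteq> V \<and> (\<forall>k. Suc k < length P \<longrightarrow> E (P ! k) (P ! Suc k))"

definition walk_between :: "'a set \<Rightarrow> ('a \<Rightarrow> 'a \<Rightarrow> bool) \<Rightarrow> 'a \<Rightarrow> 'a \<Rightarrow> 'a list \<Rightarrow> bool" where
  "walk_between V E u v P \<longleftrightarrow> is_walk V E P \<and> hd P = u \<and> last P = v"

definition gdist :: "'a set \<Rightarrow> ('a \<Rightarrow> 'a \<Rightarrow> bool) \<Rightarrow> 'a \<Rightarrow> 'a \<Rightarrow> nat" where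
  "gdist V E u v = (LEAST k. \<exists>P. walk_between V E u v P \<and> length P = Suc k)"

(* shortest u,v-path (a shortest walk is automatically a path) *)
definition shortest_path :: "'a set \<Rightarrow> ('a \<Rightarrow> 'a \<Rightarrow> bool) \<Rightarrow> 'a \<Rightarrow> 'a \<Rightarrow> 'a list \<Rightarrow> bool" where
  "shortest_path V E u v P \<longleftrightarrow> walk_between V E u v P \<and> length P = Suc (gdist V E u v)"

definition X_visible :: "'a set \<Rightarrow> ('a \<Rightarrow> 'a \<Rightarrow> bool) \<Rightarrow> 'a set \<Rightarrow> 'a \<Rightarrow> 'a \<Rightarrow> bool" where
  "X_visible V E X u v \<longleftrightarrow> (\<exists>P. shortest_path V E u v P \<and> set P \<inter> X \<subseteq> {u, v})"

definition mutual_visibility_set :: "'a set \<Rightarrow> ('a \<Rightarrow> 'a \<Rightarrow> bool) \<Rightarrow> 'a set \<Rightarrow> bool" where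
  "mutual_visibility_set V E X \<longleftrightarrow> X \<subseteq> V \<and> (\<forall>u\<in>X. \<forall>v\<in>X. X_visible V E X u v)"

definition mu :: "'a set \<Rightarrow> ('a \<Rightarrow> 'a \<Rightarrow> bool) \<Rightarrow> nat" where
  "mu V E = Max {card X | X. mutual_visibility_set V E X}"

(* Sierpinski graph S_p^n: vertices are words i_1...i_n over {0..p-1}, encoded as lists
   (positions 0-based: list index t corresponds to coordinate t+1). *)
definition sierp_V :: "nat \<Rightarrow> nat \<Rightarrow> nat list set" where
  "sierp_V p n = {xs. length xs = n \<and> set xs \<subseteq> {..<p}}"

definition sierp_E :: "nat \<Rightarrow> nat \<Rightarrow> nat list \<Rightarrow> nat list \<Rightarrow> bool" where
  "sierp_E p n xs ys \<longleftrightarrow>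
     (\<exists>h<n. (\<forall>t<h. xs ! t = ys ! t) \<and> xs ! h \<noteq> ys ! h \<and>
            (\<forall>t. h < t \<and> t < n \<longrightarrow> xs ! t = ys ! h \<and> ys ! t = xs ! h))"

definition sierp_copy :: "nat \<Rightarrow> nat \<Rightarrow> nat \<Rightarrow> nat list set" where
  "sierp_copy p n i = {xs \<in> sierp_V p n. xs ! 0 = i}"

end

theory Submission
  imports Defs
begin

text \<open>
  The geodesic from a vertex to a corner is unique, and a geodesic between two copies is made of two such
  geodesics, possibly joined by a side of the third copy. Hence mutual visibility becomes a recursive
  condition on the three parts of \<open>X\<close>. If all parts are nonempty and every vertex leaves its copy directly,
  each part must keep two of its corners visible, which leaves room for \<open>3\<^sup>n\<^sup>-\<^sup>3 + 1\<close> vertices; so one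
  bounds, by induction, the size of sets that keep a prescribed set of corners visible, the bound dropping
  by one for each such corner. A vertex of copy \<open>i\<close> that does not see the corner towards copy \<open>j\<close> forces
  detours to all vertices of \<open>X\<close> in copy \<open>j\<close>; these then lie in only two of the three subcopies, and the
  loss is larger than what is gained elsewhere. Only for \<open>n \<le> 4\<close> is this loss so small that the
  positions of single vertices matter.

  Conversely, in every \<open>S\<^sub>3\<^sup>2\<close> one inner vertex of the side facing away from its exit can be chosen without
  blocking anything, and the three corners of the whole graph can be added.
\<close>

section \<open>Distances and geodesics to a corner\<close>

text \<open>Put c = 3^(m-2). The target for order m+1 is 3c+3 = 3(c+1), and c+1 is what a part open
  to two corners may hold. A part hiding one or two corners may hold c+2 or c+3, so another part has
  to pay. If c = 3q, the part facing a hidden corner has at most 2q+3 vertices, and the estimates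
  for the three parts add up to 7q+7 or 8q+5 against 9q+3. This needs q >= 3, that is m >= 4, and it
  uses the bounds for both m and m-1. For m = 2 and m = 3 the detour inequality
  \<open>cdist k s + cdist k t + 2 ^ m \<le> cdist j s + cdist i t\<close> is exploited further: a
  vertex t only slightly closer to k than to i pushes every hidden s towards the corner k, which
  limits the part containing s.

  The clear sides in the bound for three corners arise by themselves when all copies are inhabited:
  if X is open to corner i, the vertices of copies j and k run along two sides of copy i. If a copy
  is empty they do not come for free, so they are carried along as a hypothesis on X.\<close>

abbreviation SV :: "nat \<Rightarrow> nat list set" where "SV n \<equiv> sierp_V 3 n"
abbreviation SE :: "nat \<Rightarrow> nat list \<Rightarrow> nat list \<Rightarrow> bool" where "SE n \<equiv> sierp_E 3 n"

definition triple :: "nat \<Rightarrow> nat \<Rightarrow> nat \<Rightarrow> bool" where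
  "triple i j k \<longleftrightarrow> i < 3 \<and> j < 3 \<and> k < 3 \<and> i \<noteq> j \<and> i \<noteq> k \<and> j \<noteq> k"

text \<open>The distance to corner \<open>j\<close>: outside copy \<open>j\<close>, after reaching
  the gate inside the own copy, one crosses a bridge and then a whole side of copy \<open>j\<close>,
  which takes 1 + (2^m - 1) steps with m = \<open>length s\<close>.\<close>

fun cdist :: "nat \<Rightarrow> nat list \<Rightarrow> nat" where
  "cdist j [] = 0"
| "cdist j (a # s) = (if a = j then 0 else 2 ^ length s) + cdist j s"

text \<open>The vertices of the geodesic between the corners \<open>a\<close> and \<open>b\<close>
  (see \<open>cpath_replicate\<close>); a single corner if \<open>a = b\<close>.\<close>

definition side :: "nat \<Rightarrow> nat \<Rightarrow> nat \<Rightarrow> nat list set" where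
  "side a b m = {s. length s = m \<and> set s \<subseteq> {a, b}}"

text \<open>The geodesic from a vertex to corner \<open>j\<close>: to the gate of its copy, over the
  bridge, along the side of copy \<open>j\<close>. Only the vertex set is kept, since visibility
  asks for nothing else.\<close>

fun cpath :: "nat \<Rightarrow> nat list \<Rightarrow> nat list set" where
  "cpath j [] = {[]}"
| "cpath j (a # s) =
     Cons a ` cpath j s \<union> (if a = j then {} else Cons j ` side a j (length s))"

definition slice :: "nat \<Rightarrow> nat list set \<Rightarrow> nat list set" where
  "slice a X = {s. a # s \<in> X}"

text \<open>Only the start is exempt: if the corner itself belongs to \<open>X\<close>, no other
  vertex sees it.\<close>

definition sees :: "nat list set \<Rightarrow> nat \<Rightarrow> nat list \<Rightarrow> bool" where
  "sees X j s \<longleftrightarrow> cpath j s \<inter> X \<subseteq> {s}"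

lemma triple_ex:
  assumes "i < 3" "j < 3" "i \<noteq> j"
  obtains k where "triple i j k"
proof
  show "triple i j (3 - i - j)"
    using assms by (auto simp: triple_def less_Suc_eq numeral_3_eq_3)
qed

lemma triple_less: "triple i j k \<Longrightarrow> a < 3 \<longleftrightarrow> a = i \<or> a = j \<or> a = k"
  by (auto simp: triple_def)

lemma SV_0 [simp]: "SV 0 = {[]}"
  by (auto simp: sierp_V_def)

lemma SV_Cons [simp]: "a # s \<in> SV (Suc m) \<longleftrightarrow> a < 3 \<and> s \<in> SV m"
  by (auto simp: sierp_V_def)

lemma SV_length: "s \<in> SV m \<Longrightarrow> length s = m"
  by (simp add: sierp_V_def)

lemma SV_SucE:
  assumes "v \<in> SV (Suc m)"
  obtains a s where "v = a # s" "a < 3" "s \<in> SV m"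
  using assms by (cases v) (auto simp: sierp_V_def)

lemma SV_replicate [simp]: "a < 3 \<Longrightarrow> replicate m a \<in> SV m"
  by (auto simp: sierp_V_def)

lemma SE_Cons:
  assumes "length s = m" "length t = m"
  shows "SE (Suc m) (a # s) (b # t) \<longleftrightarrow>
    (a = b \<and> SE m s t) \<or> (a \<noteq> b \<and> s = replicate m b \<and> t = replicate m a)"
proof (cases "a = b")
  case True
  have *: "(\<forall>u. Suc h < u \<and> u < Suc m \<longrightarrow> P u) \<longleftrightarrow> (\<forall>u. h < u \<and> u < m \<longrightarrow> P (Suc u))" for h P
    by (metis Suc_less_eq Suc_less_eq2)
  have "SE (Suc m) (a # s) (b # t) \<longleftrightarrow> SE m s t"
    unfolding sierp_E_def Ex_less_Suc2 using True by (simp add: * All_less_Suc2)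
  then show ?thesis using True by simp
next
  case False
  have *: "(\<forall>u. 0 < u \<and> u < Suc m \<longrightarrow> P u) \<longleftrightarrow> (\<forall>u < m. P (Suc u))" for P
    by (metis Suc_less_eq gr0_conv_Suc)
  have "SE (Suc m) (a # s) (b # t) \<longleftrightarrow> (\<forall>u < m. s ! u = b \<and> t ! u = a)"
    unfolding sierp_E_def Ex_less_Suc2 using False by (simp add: * All_less_Suc2)
  also have "\<dots> \<longleftrightarrow> s = replicate m b \<and> t = replicate m a"
    using assms by (auto simp: list_eq_iff_nth_eq)
  finally show ?thesis using False by simp
qed

lemma SE_sym:
  assumes "SE n s t"
  shows "SE n t s"
proof -
  obtain h where "h < n" "\<forall>u<h. s ! u = t ! u" "s ! h \<noteq> t ! h"
    "\<forall>u. h < u \<and> u < n \<longrightarrow> s ! u = t ! h \<and> t ! u = s ! h"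
    using assms unfolding sierp_E_def by blast
  then show ?thesis
    unfolding sierp_E_def by (intro exI[of _ h]) auto
qed

lemma cdist_less: "cdist j s < 2 ^ length s"
  by (induction s) auto

lemma cdist_replicate_same [simp]: "cdist j (replicate m j) = 0"
  by (induction m) auto

lemma cdist_replicate: "a \<noteq> j \<Longrightarrow> cdist j (replicate m a) = 2 ^ m - 1"
  by (induction m) auto

lemma cdist_replicate': "a \<noteq> j \<Longrightarrow> Suc (cdist j (replicate m a)) = 2 ^ m"
  by (simp add: cdist_replicate)

lemma side_commute: "side a b m = side b a m"
  by (simp add: side_def insert_commute)

lemma side_0 [simp]: "side a b 0 = {[]}"
  by (auto simp: side_def)

lemma side_Cons [simp]: "c # s \<in> side a b (Suc m) \<longleftrightarrow> (c = a \<or> c = b) \<and> s \<in> side a b m"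
  by (auto simp: side_def)

lemma side_Suc: "side a b (Suc m) = Cons a ` side a b m \<union> Cons b ` side a b m"
  by (auto simp: side_def length_Suc_conv)

lemma replicate_in_side [simp]: "replicate m a \<in> side a b m" "replicate m b \<in> side a b m"
  by (auto simp: side_def)

lemma side_same: "side a a m = {replicate m a}"
  by (induction m) (auto simp: side_Suc)

lemma cpath_replicate: "cpath j (replicate m a) = side a j m"
  by (induction m) (auto simp: side_Suc side_same)

lemma cpath_self [simp]: "s \<in> cpath j s"
  by (induction s) auto

text \<open>Inside a copy this is the induction hypothesis. The ends of a bridge have equal distance
  unless one of them lies in copy \<open>j\<close>; then the distances are 2^m and 2^m - 1.\<close>

lemma SE_cdist:
  assumes "SE m s t" "s \<in> SV m" "t \<in> SV m"
  shows "cdist j s \<le> Suc (cdist j t)"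
  using assms
proof (induction m arbitrary: s t)
  case 0
  then show ?case by simp
next
  case (Suc m)
  obtain a s' b t' where st: "s = a # s'" "t = b # t'" "s' \<in> SV m" "t' \<in> SV m"
    using Suc.prems by (meson SV_SucE)
  with Suc.prems have "(a = b \<and> SE m s' t') \<or> (a \<noteq> b \<and> s' = replicate m b \<and> t' = replicate m a)"
    by (simp add: SE_Cons SV_length)
  then show ?case
  proof
    assume "a = b \<and> SE m s' t'"
    then show ?thesis using Suc.IH[of s' t'] st by (auto simp: SV_length)
  next
    assume "a \<noteq> b \<and> s' = replicate m b \<and> t' = replicate m a"
    then show ?thesis using st
      by (cases "a = j"; cases "b = j") (auto simp: cdist_replicate)
  qed
qed

text \<open>The local form of uniqueness: a step that comes closer to the corner runs along
  \<open>cpath\<close>. A bridge gains a step only by entering copy \<open>j\<close>, and there the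
  rest of the way is a side.\<close>

lemma SE_cpath:
  assumes "SE m s t" "s \<in> SV m" "t \<in> SV m" "cdist j s = Suc (cdist j t)"
  shows "cpath j s \<subseteq> insert s (cpath j t)"
  using assms
proof (induction m arbitrary: s t)
  case 0
  then show ?case by simp
next
  case (Suc m)
  obtain a s' b t' where st: "s = a # s'" "t = b # t'" "s' \<in> SV m" "t' \<in> SV m"
    using Suc.prems by (meson SV_SucE)
  with Suc.prems have "(a = b \<and> SE m s' t') \<or> (a \<noteq> b \<and> s' = replicate m b \<and> t' = replicate m a)"
    by (simp add: SE_Cons SV_length)
  moreover have d: "cdist j s = (if a = j then 0 else 2 ^ m) + cdist j s'"
    "cdist j t = (if b = j then 0 else 2 ^ m) + cdist j t'"
    using st by (auto simp: SV_length)
  ultimately show ?case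
  proof (elim disjE conjE)
    assume ab: "a = b" "SE m s' t'"
    then have "cdist j s' = Suc (cdist j t')"
      using d Suc.prems(4) by (simp split: if_splits)
    then have "cpath j s' \<subseteq> insert s' (cpath j t')"
      using Suc.IH ab st by blast
    then have "Cons a ` cpath j s' \<subseteq> insert (a # s') (Cons a ` cpath j t')"
      by blast
    then show ?thesis using st ab by (auto simp: SV_length)
  next
    assume ab: "a \<noteq> b" "s' = replicate m b" "t' = replicate m a"
    have "a \<noteq> j \<and> b = j"
    proof (rule ccontr)
      assume "\<not> (a \<noteq> j \<and> b = j)"
      then consider "a = j" | "a \<noteq> j" "b \<noteq> j" by blast
      then have "cdist j s \<le> cdist j t"
        by cases (use d ab in \<open>simp_all add: cdist_replicate\<close>)
      then show False using Suc.prems(4) by linarith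
    qed
    with ab st show ?thesis by (auto simp: cpath_replicate side_same)
  qed
qed

section \<open>Walks measured by their distance to a corner\<close>

lemma is_walk_single [simp]: "is_walk V E [x] \<longleftrightarrow> x \<in> V"
  by (simp add: is_walk_def)

lemma is_walk_Cons2 [simp]:
  "is_walk V E (x # y # P) \<longleftrightarrow> x \<in> V \<and> E x y \<and> is_walk V E (y # P)"
proof -
  have "(\<forall>k. Suc k < length (x # y # P) \<longrightarrow> E ((x # y # P) ! k) ((x # y # P) ! Suc k)) \<longleftrightarrow>
     E x y \<and> (\<forall>k. Suc k < length (y # P) \<longrightarrow> E ((y # P) ! k) ((y # P) ! Suc k))"
    by (simp add: All_less_Suc2 flip: less_Suc_eq_le)
  then show ?thesis
    unfolding is_walk_def by (simp only: set_simps insert_subset) blast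
qed

lemma is_walk_Nil [simp]: "\<not> is_walk V E []"
  by (simp add: is_walk_def)

lemma is_walk_append:
  "P \<noteq> [] \<Longrightarrow> Q \<noteq> [] \<Longrightarrow>
   is_walk V E (P @ Q) \<longleftrightarrow> is_walk V E P \<and> is_walk V E Q \<and> E (last P) (hd Q)"
proof (induction P rule: induct_list012)
  case (2 x)
  then show ?case by (cases Q) auto
qed auto

lemma is_walk_rev:
  assumes "is_walk (SV n) (SE n) P"
  shows "is_walk (SV n) (SE n) (rev P)"
  using assms
proof (induction P rule: induct_list012)
  case (3 x y P)
  then have "is_walk (SV n) (SE n) ((rev P @ [y]) @ [x])"
    using 3 by (subst is_walk_append) (simp_all add: SE_sym[of n x y])
  then show ?case by simp
qed auto

lemma is_walk_map_Cons:
  assumes "a < 3"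
  shows "is_walk (SV (Suc m)) (SE (Suc m)) (map (Cons a) P) \<longleftrightarrow> is_walk (SV m) (SE m) P"
  using assms
proof (induction P rule: induct_list012)
  case (3 x y P)
  have "is_walk (SV m) (SE m) (y # P) \<Longrightarrow> y \<in> SV m"
    by (simp add: is_walk_def)
  with 3 show ?case by (auto simp: SE_Cons SV_length)
qed auto

text \<open>\<open>length P\<close> counts vertices, one more than steps; hence the strict
  inequality here and the \<open>Suc\<close> in the tight case below.\<close>

lemma walk_cdist:
  assumes "is_walk (SV m) (SE m) P"
  shows "cdist j (hd P) < cdist j (last P) + length P"
  using assms
proof (induction P rule: induct_list012)
  case (3 x y P)
  have "y \<in> SV m" "SE m x y" "x \<in> SV m"
    using "3.prems" by (auto simp: is_walk_def)
  then have "cdist j x \<le> Suc (cdist j y)"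
    by (rule SE_cdist[rotated -1]) 
  with 3 show ?case by simp
qed auto

text \<open>Tightness passes to every step, so \<open>SE_cpath\<close> applies all along. The end is
  left arbitrary because \<open>cross_walk\<close> needs this for a segment that stops at the border
  of the third copy.\<close>

lemma walk_cpath:
  assumes "is_walk (SV m) (SE m) P" "Suc (cdist j (hd P)) = cdist j (last P) + length P"
  shows "cpath j (hd P) \<subseteq> set P \<union> cpath j (last P)"
  using assms
proof (induction P rule: induct_list012)
  case (3 x y P)
  have xy: "y \<in> SV m" "SE m x y" "x \<in> SV m" and w: "is_walk (SV m) (SE m) (y # P)"
    using "3.prems" by (auto simp: is_walk_def)
  have 1: "cdist j x \<le> Suc (cdist j y)"
    using xy by (metis SE_cdist)
  have 2: "cdist j y < cdist j (last (y # P)) + length (y # P)"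
    using walk_cdist[OF w] by simp
  have 3: "Suc (cdist j x) = cdist j (last (y # P)) + Suc (length (y # P))"
    using "3.prems"(2) by simp
  have eq: "cdist j x = Suc (cdist j y)"
    using 1 2 3 by linarith
  have "cpath j (hd (y # P)) \<subseteq> set (y # P) \<union> cpath j (last (y # P))"
    by (rule "3.IH"(2)) (use w 3 eq in auto)
  moreover have "cpath j x \<subseteq> insert x (cpath j y)"
    using xy eq by (metis SE_cpath)
  ultimately show ?case by auto
qed auto

lemma walk_to_corner_length:
  assumes "walk_between (SV m) (SE m) s (replicate m j) P"
  shows "cdist j s < length P"
  using walk_cdist[of m P j] assms by (simp add: walk_between_def)

lemma walk_to_corner_cpath:
  assumes "walk_between (SV m) (SE m) s (replicate m j) P" "length P = Suc (cdist j s)"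
  shows "cpath j s \<subseteq> set P"
proof -
  have "P \<noteq> []" using assms(2) by auto
  then have "last P \<in> set P" by simp
  with walk_cpath[of m P j] assms show ?thesis
    by (auto simp: walk_between_def cpath_replicate side_same)
qed

lemma walk_between_rev:
  "walk_between (SV m) (SE m) s t P \<Longrightarrow> walk_between (SV m) (SE m) t s (rev P)"
  by (auto simp: walk_between_def is_walk_rev hd_rev last_rev)

lemma walk_between_map_Cons:
  "a < 3 \<Longrightarrow> walk_between (SV (Suc m)) (SE (Suc m)) (a # s) (a # t) (map (Cons a) P)
    \<longleftrightarrow> walk_between (SV m) (SE m) s t P"
  by (cases "P = []") (auto simp: walk_between_def is_walk_map_Cons hd_map last_map)

lemma walk_between_append:
  assumes "walk_between V E a b P" "walk_between V E c d Q" "E b c"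
  shows "walk_between V E a d (P @ Q)"
proof -
  have "P \<noteq> []" "Q \<noteq> []" using assms by (auto simp: walk_between_def)
  then show ?thesis using assms by (auto simp: walk_between_def is_walk_append)
qed

lemma SE_bridge: "a \<noteq> b \<Longrightarrow> SE (Suc m) (a # replicate m b) (b # replicate m a)"
  by (simp add: SE_Cons)

lemma walk_to_corner_ex:
  assumes "s \<in> SV m" "j < 3"
  shows "\<exists>P. walk_between (SV m) (SE m) s (replicate m j) P \<and> length P = Suc (cdist j s)
    \<and> set P \<subseteq> cpath j s"
  using assms(1)
proof (induction m arbitrary: s)
  case 0
  then show ?case
    by (intro exI[of _ "[[]]"]) (auto simp: walk_between_def)
next
  case (Suc m)
  obtain a s' where s: "s = a # s'" "a < 3" "s' \<in> SV m"
    using Suc.prems by (metis SV_SucE)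
  show ?case
  proof (cases "a = j")
    case True
    obtain P where P: "walk_between (SV m) (SE m) s' (replicate m j) P" "length P = Suc (cdist j s')"
      "set P \<subseteq> cpath j s'"
      using Suc.IH s by blast
    then show ?thesis
      using True s by (intro exI[of _ "map (Cons j) P"]) (auto simp: walk_between_map_Cons)
  next
    case False
    obtain P where P: "walk_between (SV m) (SE m) s' (replicate m j) P" "length P = Suc (cdist j s')"
      "set P \<subseteq> cpath j s'"
      using Suc.IH s by blast
    obtain Q where Q: "walk_between (SV m) (SE m) (replicate m a) (replicate m j) Q"
      "length Q = Suc (cdist j (replicate m a))" "set Q \<subseteq> cpath j (replicate m a)"
      using Suc.IH s(2) by (meson SV_replicate)
    have "walk_between (SV (Suc m)) (SE (Suc m)) s (j # replicate m j) (map (Cons a) P @ map (Cons j) Q)"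
      by (rule walk_between_append) (rule_tac [3] SE_bridge[OF False],
         use s P Q assms in \<open>simp_all add: walk_between_map_Cons\<close>)
    moreover have "length (map (Cons a) P @ map (Cons j) Q) = Suc (cdist j s)"
      using P Q s False by (simp add: cdist_replicate' SV_length)
    moreover have "set (map (Cons a) P @ map (Cons j) Q) \<subseteq> cpath j s"
      using P Q s False by (auto simp: cpath_replicate SV_length)
    ultimately show ?thesis
      by (intro exI[of _ "map (Cons a) P @ map (Cons j) Q"]) (simp only: replicate_Suc simp_thms)
  qed
qed

lemma walk_ex_short:
  assumes "s \<in> SV m" "t \<in> SV m"
  shows "\<exists>P. walk_between (SV m) (SE m) s t P \<and> length P \<le> 2 ^ m"
  using assms
proof (induction m arbitrary: s t)
  case 0
  then show ?case
    by (intro exI[of _ "[[]]"]) (auto simp: walk_between_def)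
next
  case (Suc m)
  obtain a s' b t' where st: "s = a # s'" "t = b # t'" "s' \<in> SV m" "t' \<in> SV m" "a < 3" "b < 3"
    using Suc.prems by (meson SV_SucE)
  show ?case
  proof (cases "a = b")
    case True
    obtain P where "walk_between (SV m) (SE m) s' t' P \<and> length P \<le> 2 ^ m"
      using Suc.IH st by blast
    then show ?thesis
      using True st by (intro exI[of _ "map (Cons a) P"]) (auto simp: walk_between_map_Cons)
  next
    case False
    obtain P where P: "walk_between (SV m) (SE m) s' (replicate m b) P" "length P \<le> 2 ^ m"
      using Suc.IH st by (meson SV_replicate)
    obtain Q where Q: "walk_between (SV m) (SE m) (replicate m a) t' Q" "length Q \<le> 2 ^ m"
      using Suc.IH st by (meson SV_replicate)
    have "walk_between (SV (Suc m)) (SE (Suc m)) s t (map (Cons a) P @ map (Cons b) Q)"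
      by (rule walk_between_append) (rule_tac [3] SE_bridge[OF False],
         use st P Q in \<open>simp_all add: walk_between_map_Cons\<close>)
    then show ?thesis using P Q by (intro exI[of _ "map (Cons a) P @ map (Cons b) Q"]) simp
  qed
qed

text \<open>The cut is made at the first departure from copy \<open>i\<close>, which has to use a
  bridge; so \<open>P1\<close> ends in a corner of the copy and \<open>P2\<close> starts at the
  other end of that bridge.\<close>

lemma walk_exit:
  assumes "is_walk (SV (Suc m)) (SE (Suc m)) P" "hd P = i # s" "\<exists>v\<in>set P. hd v \<noteq> i"
  shows "\<exists>P1 P2 e. P = map (Cons i) P1 @ P2 \<and> P2 \<noteq> [] \<and> walk_between (SV m) (SE m) s (replicate m e) P1
    \<and> hd P2 = e # replicate m i \<and> is_walk (SV (Suc m)) (SE (Suc m)) P2 \<and> e \<noteq> i \<and> e < 3"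
  using assms
proof (induction P arbitrary: s rule: induct_list012)
  case (3 x y P)
  have x: "x = i # s" using "3.prems" by simp
  have xy: "x \<in> SV (Suc m)" "SE (Suc m) x y" and w: "is_walk (SV (Suc m)) (SE (Suc m)) (y # P)"
    using "3.prems" by auto
  then have "y \<in> SV (Suc m)" by (auto simp: is_walk_def)
  then obtain b t where y: "y = b # t" "b < 3" "t \<in> SV m" by (metis SV_SucE)
  have s: "i < 3" "s \<in> SV m" using x xy by auto
  show ?case
  proof (cases "b = i")
    case True
    have e: "SE m s t" using xy True x y s by (simp add: SE_Cons SV_length)
    have "\<exists>P1 P2 e. y # P = map (Cons i) P1 @ P2 \<and> P2 \<noteq> [] \<and> walk_between (SV m) (SE m) t (replicate m e) P1
    \<and> hd P2 = e # replicate m i \<and> is_walk (SV (Suc m)) (SE (Suc m)) P2 \<and> e \<noteq> i \<and> e < 3"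
      by (rule "3.IH"(2)) (use True y w "3.prems"(3) x in auto)
    then obtain P1 P2 e where P: "y # P = map (Cons i) P1 @ P2" "P2 \<noteq> []"
      "walk_between (SV m) (SE m) t (replicate m e) P1"
      "hd P2 = e # replicate m i" "is_walk (SV (Suc m)) (SE (Suc m)) P2" "e \<noteq> i" "e < 3"
      by blast
    have "walk_between (SV m) (SE m) s (replicate m e) ([s] @ P1)"
      by (rule walk_between_append[OF _ P(3) e]) (use s in \<open>simp add: walk_between_def\<close>)
    then show ?thesis using P x by (intro exI[of _ "[s] @ P1"] exI[of _ P2] exI[of _ e]) auto
  next
    case False
    then have "s = replicate m b" "t = replicate m i"
      using xy x y s by (auto simp: SE_Cons SV_length)
    then show ?thesis using x y s w False
      by (intro exI[of _ "[s]"] exI[of _ "y # P"] exI[of _ b]) (auto simp: walk_between_def)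
  qed
qed auto

lemma walk_entry:
  assumes "is_walk (SV (Suc m)) (SE (Suc m)) P" "last P = j # t" "\<exists>v\<in>set P. hd v \<noteq> j"
  shows "\<exists>P1 P2 e. P = P2 @ map (Cons j) P1 \<and> P2 \<noteq> [] \<and> walk_between (SV m) (SE m) (replicate m e) t P1
    \<and> last P2 = e # replicate m j \<and> is_walk (SV (Suc m)) (SE (Suc m)) P2 \<and> e \<noteq> j \<and> e < 3"
proof -
  obtain P1 P2 e where P: "rev P = map (Cons j) P1 @ P2" "P2 \<noteq> []"
      "walk_between (SV m) (SE m) t (replicate m e) P1"
      "hd P2 = e # replicate m j" "is_walk (SV (Suc m)) (SE (Suc m)) P2" "e \<noteq> j" "e < 3"
    using walk_exit[of m "rev P" j t] assms by (auto simp: is_walk_rev hd_rev)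
  have "P = rev P2 @ map (Cons j) (rev P1)"
    using P(1) by (metis rev_append rev_map rev_rev_ident)
  then show ?thesis
    using P(2-) walk_between_rev[OF P(3)] is_walk_rev[OF P(5)]
    by (intro exI[of _ "rev P1"] exI[of _ "rev P2"] exI[of _ e]) (auto simp: last_rev)
qed

section \<open>Geodesics between and within copies\<close>

text \<open>Let \<open>e\<close> be the copy entered on first leaving \<open>i\<close>, and
  \<open>e'\<close> the copy from which \<open>j\<close> is entered for the last time. If exactly
  one of the two is \<open>k\<close>, the walk is longer than the direct one; otherwise it covers a
  candidate or exceeds its length. Which of \<open>D\<close> and \<open>I\<close> is smaller is left
  open: the caller compares with both explicit walks.\<close>

lemma cross_walk:
  assumes ijk: "triple i j k" and s: "s \<in> SV m" and t: "t \<in> SV m"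
    and P: "walk_between (SV (Suc m)) (SE (Suc m)) (i # s) (j # t) P"
  defines "D \<equiv> cdist j s + cdist i t + 1" and "I \<equiv> cdist k s + cdist k t + 2 ^ m + 1"
  shows "length P > Suc D
    \<or> length P \<ge> Suc D \<and> Cons i ` cpath j s \<union> Cons j ` cpath i t \<subseteq> set P
    \<or> length P > Suc I
    \<or> length P \<ge> Suc I \<and> Cons i ` cpath k s \<union> Cons k ` side i j m \<union> Cons j ` cpath k t \<subseteq> set P"
proof -
  have dist: "i \<noteq> j" "i \<noteq> k" "j \<noteq> k" "i < 3" "j < 3" "k < 3"
    using ijk by (auto simp: triple_def)
  have w: "is_walk (SV (Suc m)) (SE (Suc m)) P" "hd P = i # s" "last P = j # t" "P \<noteq> []"
    using P by (auto simp: walk_between_def)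
  have "j # t \<in> set P" using w by (metis last_in_set)
  then have "\<exists>v\<in>set P. hd v \<noteq> i" using dist by (metis list.sel(1))
  then obtain P1 R e where R: "P = map (Cons i) P1 @ R" "R \<noteq> []"
    "walk_between (SV m) (SE m) s (replicate m e) P1" "hd R = e # replicate m i"
    "is_walk (SV (Suc m)) (SE (Suc m)) R" "e \<noteq> i" "e < 3"
    using walk_exit[OF w(1,2)] by blast
  have e: "e = j \<or> e = k" using R dist triple_less[OF ijk] by blast
  have P1: "cdist e s < length P1" "length P1 = Suc (cdist e s) \<Longrightarrow> cpath e s \<subseteq> set P1"
    using walk_to_corner_length[OF R(3)] walk_to_corner_cpath[OF R(3)] by auto
  have lR: "last R = j # t" using R w by simp
  have ts: "cdist i t < 2 ^ m" "cdist j s < 2 ^ m"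
    using cdist_less[of i t] cdist_less[of j s] s t by (simp_all add: SV_length)
  show ?thesis
  proof (cases "\<exists>v\<in>set R. hd v \<noteq> j")
    case False
    have "hd R \<in> set R" using R(2) by (rule hd_in_set)
    then have ej: "e = j" using False R by fastforce
    have "\<forall>v\<in>set R. v = j # tl v"
    proof
      fix v assume v: "v \<in> set R"
      then have "v \<in> SV (Suc m)" using R by (auto simp: is_walk_def)
      then show "v = j # tl v" using False v by (metis SV_SucE list.sel(1,3))
    qed
    then have RR: "R = map (Cons j) (map tl R)" by (simp add: map_idI)
    have "walk_between (SV (Suc m)) (SE (Suc m)) (j # replicate m i) (j # t) (map (Cons j) (map tl R))"
      using RR R lR ej by (simp add: walk_between_def)
    then have "walk_between (SV m) (SE m) (replicate m i) t (map tl R)"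
      by (simp only: walk_between_map_Cons[OF dist(5)])
    then have R': "walk_between (SV m) (SE m) t (replicate m i) (rev (map tl R))"
      by (rule walk_between_rev)
    note P1 = P1[unfolded ej]
    have l: "length P = length P1 + length (rev (map tl R))" using R by simp
    have 2: "cdist i t < length (rev (map tl R))"
       "length (rev (map tl R)) = Suc (cdist i t) \<Longrightarrow> cpath i t \<subseteq> set (rev (map tl R))"
      using walk_to_corner_length[OF R'] walk_to_corner_cpath[OF R'] by auto
    show ?thesis
    proof (cases "length P > Suc D")
      case False
      then have "length P1 = Suc (cdist j s)" "length (rev (map tl R)) = Suc (cdist i t)"
        using P1(1) 2(1) l ej unfolding D_def by linarith+
      then have "cpath j s \<subseteq> set P1" "cpath i t \<subseteq> tl ` set R" using P1 2 ej by auto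
      moreover have "set P = Cons i ` set P1 \<union> Cons j ` tl ` set R"
      proof -
        have "set R = Cons j ` tl ` set R" using RR by (metis list.set_map)
        then show ?thesis using R by simp
      qed
      ultimately have "Cons i ` cpath j s \<union> Cons j ` cpath i t \<subseteq> set P" by blast
      moreover have "length P \<ge> Suc D"
        using P1(1) 2(1) l ej unfolding D_def by linarith
      ultimately show ?thesis by blast
    qed simp
  next
    case True
    then obtain P4 Q e' where Q: "R = Q @ map (Cons j) P4" "Q \<noteq> []"
      "walk_between (SV m) (SE m) (replicate m e') t P4" "last Q = e' # replicate m j"
      "is_walk (SV (Suc m)) (SE (Suc m)) Q" "e' \<noteq> j" "e' < 3"
      using walk_entry[OF R(5) lR] by blast
    have e': "e' = i \<or> e' = k" using Q dist triple_less[OF ijk] by blast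
    note P4' = walk_between_rev[OF Q(3)]
    have P4: "cdist e' t < length P4" "length P4 = Suc (cdist e' t) \<Longrightarrow> cpath e' t \<subseteq> set P4"
      using walk_to_corner_length[OF P4'] walk_to_corner_cpath[OF P4'] by auto
    have l: "length P = length P1 + length Q + length P4" using R Q by simp
    have hQ: "hd Q = e # replicate m i" using R(4) Q(1,2) by simp
    have Ql: "length Q \<ge> 1" using Q(2) by (simp add: Suc_leI)
    note wl = walk_cdist[OF Q(5), unfolded hQ Q(4)]
    have p: "(2::nat) ^ m \<ge> 1" by simp
    consider "e = j" "e' = i" | "e = j" "e' = k" | "e = k" "e' = i" | "e = k" "e' = k"
      using e e' by blast
    then show ?thesis
    proof cases
      case 1
      note P1 = P1[unfolded 1] and P4 = P4[unfolded 1]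
      then have "length P > Suc D" using P1(1) P4(1) l Ql unfolding D_def by linarith
      then show ?thesis by blast
    next
      case 2
      note P1 = P1[unfolded 2] and P4 = P4[unfolded 2]
      \<comment> \<open>On the way from \<open>j # replicate m i\<close> to
        \<open>k # replicate m j\<close> the distance to corner \<open>k\<close> falls from 2^(m+1)
        - 1 to 2^m - 1.\<close>
      have "length Q \<ge> 2 ^ m + 1"
        using wl[of k] 2 dist p by (simp add: cdist_replicate)
      then have "length P > Suc D" using P1(1) P4(1) l 2 ts unfolding D_def by linarith
      then show ?thesis by blast
    next
      case 3
      note P1 = P1[unfolded 3] and P4 = P4[unfolded 3]
      have "length Q \<ge> 2 ^ m"
        using wl[of j] 3 dist p by (simp add: cdist_replicate)
      then have "length P > Suc D" using P1(1) P4(1) l 3 ts unfolding D_def by linarith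
      then show ?thesis by blast
    next
      case 4
      note P1 = P1[unfolded 4] and P4 = P4[unfolded 4]
      have Qge: "length Q \<ge> 2 ^ m"
        using wl[of j] 4 dist p by (simp add: cdist_replicate)
      show ?thesis
      proof (cases "length P > Suc I")
        case False
        then have ll: "length P1 = Suc (cdist k s)" "length P4 = Suc (cdist k t)" "length Q = 2 ^ m"
          using P1(1) P4(1) Qge l 4 unfolding I_def by linarith+
        then have "cpath k s \<subseteq> set P1" "cpath k t \<subseteq> set P4" using P1 P4 4 by auto
        \<comment> \<open>\<open>Q\<close> is tight towards corner \<open>j\<close> of the whole
          graph although it stops at the border of copy \<open>k\<close>; what \<open>cpath\<close>
          has beyond that end lies in copy \<open>j\<close>.\<close>
        moreover have "Cons k ` side i j m \<subseteq> set Q"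
        proof -
          have "Suc (cdist j (hd Q)) = cdist j (last Q) + length Q"
            using ll(3) hQ Q(4) 4 dist p by (simp add: cdist_replicate)
          then have "cpath j (hd Q) \<subseteq> set Q \<union> cpath j (last Q)"
            using walk_cpath[OF Q(5)] by blast
          moreover have "Cons k ` side i j m \<subseteq> cpath j (hd Q)"
            using hQ 4 by (auto simp: cpath_replicate)
          moreover have "cpath j (last Q) = insert (k # replicate m j) (Cons j ` side k j m)"
            using Q(4) 4 dist by (simp add: cpath_replicate side_same)
          moreover have "k # replicate m j \<in> set Q"
            using Q(2,4) 4 by (metis last_in_set)
          ultimately have "v \<in> set Q" if "v \<in> Cons k ` side i j m" for v
            using that dist(3) by (metis (no_types, lifting) UnE imageE insertE list.inject subsetD)
          then show ?thesis by blast
        qed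
        moreover have "set P = Cons i ` set P1 \<union> set Q \<union> Cons j ` set P4"
          using R Q by auto
        ultimately have "Cons i ` cpath k s \<union> Cons k ` side i j m \<union> Cons j ` cpath k t \<subseteq> set P"
          by blast
        moreover have "length P \<ge> Suc I"
          using ll l unfolding I_def by linarith
        ultimately show ?thesis by blast
      qed simp
    qed
  qed
qed

lemma direct_walk_ex:
  assumes "i \<noteq> j" "i < 3" "j < 3" and s: "s \<in> SV m" and t: "t \<in> SV m"
  shows "\<exists>P. walk_between (SV (Suc m)) (SE (Suc m)) (i # s) (j # t) P
    \<and> length P = Suc (cdist j s + cdist i t + 1)
    \<and> set P \<subseteq> Cons i ` cpath j s \<union> Cons j ` cpath i t"
proof -
  obtain P where P: "walk_between (SV m) (SE m) s (replicate m j) P" "length P = Suc (cdist j s)"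
    "set P \<subseteq> cpath j s"
    using walk_to_corner_ex[OF s] assms by blast
  obtain Q where Q: "walk_between (SV m) (SE m) t (replicate m i) Q" "length Q = Suc (cdist i t)"
    "set Q \<subseteq> cpath i t"
    using walk_to_corner_ex[OF t] assms by blast
  have "walk_between (SV (Suc m)) (SE (Suc m)) (i # s) (j # t) (map (Cons i) P @ map (Cons j) (rev Q))"
    by (rule walk_between_append[where b = "i # replicate m j" and c = "j # replicate m i"])
      (use assms P Q in \<open>simp_all only: walk_between_map_Cons walk_between_rev SE_bridge simp_thms\<close>)
  then show ?thesis
    using P Q by (intro exI[of _ "map (Cons i) P @ map (Cons j) (rev Q)"]) auto
qed

lemma indirect_walk_ex:
  assumes ijk: "triple i j k" and s: "s \<in> SV m" and t: "t \<in> SV m"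
  shows "\<exists>P. walk_between (SV (Suc m)) (SE (Suc m)) (i # s) (j # t) P
    \<and> length P = Suc (cdist k s + cdist k t + 2 ^ m + 1)
    \<and> set P \<subseteq> Cons i ` cpath k s \<union> Cons k ` side i j m \<union> Cons j ` cpath k t"
proof -
  have dist: "i \<noteq> j" "i \<noteq> k" "k \<noteq> j" "i < 3" "j < 3" "k < 3"
    using ijk by (auto simp: triple_def)
  obtain P where P: "walk_between (SV m) (SE m) s (replicate m k) P" "length P = Suc (cdist k s)"
    "set P \<subseteq> cpath k s"
    using walk_to_corner_ex[OF s] dist by blast
  obtain Q where Q: "walk_between (SV m) (SE m) t (replicate m k) Q" "length Q = Suc (cdist k t)"
    "set Q \<subseteq> cpath k t"
    using walk_to_corner_ex[OF t] dist by blast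
  obtain R where R: "walk_between (SV m) (SE m) (replicate m i) (replicate m j) R"
    "length R = Suc (cdist j (replicate m i))" "set R \<subseteq> cpath j (replicate m i)"
    using walk_to_corner_ex[of "replicate m i" m j] dist by auto
  have lR: "length R = 2 ^ m" using R(2) dist by (simp add: cdist_replicate)
  have "walk_between (SV (Suc m)) (SE (Suc m)) (i # s) (k # replicate m j) (map (Cons i) P @ map (Cons k) R)"
    by (rule walk_between_append[where b = "i # replicate m k" and c = "k # replicate m i"])
      (use dist P R in \<open>simp_all only: walk_between_map_Cons SE_bridge simp_thms\<close>)
  then have "walk_between (SV (Suc m)) (SE (Suc m)) (i # s) (j # t)
      ((map (Cons i) P @ map (Cons k) R) @ map (Cons j) (rev Q))"
    by (rule walk_between_append[where b = "k # replicate m j" and c = "j # replicate m k"])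
      (use dist P Q R in \<open>simp_all only: walk_between_map_Cons walk_between_rev SE_bridge simp_thms\<close>)
  then show ?thesis
    using P Q R lR by (intro exI[of _ "(map (Cons i) P @ map (Cons k) R) @ map (Cons j) (rev Q)"])
      (auto simp: cpath_replicate)
qed

section \<open>Shortest paths and visibility across and within copies\<close>

lemma gdist_le:
  assumes "walk_between V E u v P"
  shows "Suc (gdist V E u v) \<le> length P"
proof -
  have "length P = Suc (length P - 1)"
    using assms by (cases P) (auto simp: walk_between_def is_walk_def)
  then have "gdist V E u v \<le> length P - 1"
    unfolding gdist_def using assms by (intro Least_le) auto
  then show ?thesis using \<open>length P = Suc (length P - 1)\<close> by simp
qed

lemma shortest_pathI:
  assumes "walk_between V E u v P" "\<And>Q. walk_between V E u v Q \<Longrightarrow> length P \<le> length Q"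
  shows "shortest_path V E u v P"
proof -
  have "length P = Suc (length P - 1)"
    using assms by (cases P) (auto simp: walk_between_def is_walk_def)
  moreover have "gdist V E u v = length P - 1"
    unfolding gdist_def
  proof (rule Least_equality)
    show "\<exists>Q. walk_between V E u v Q \<and> length Q = Suc (length P - 1)"
      using assms calculation by metis
    show "length P - 1 \<le> y" if "\<exists>Q. walk_between V E u v Q \<and> length Q = Suc y" for y
      using that assms(2) by fastforce
  qed
  ultimately show ?thesis using assms(1) by (simp add: shortest_path_def)
qed

lemma shortest_path_le:
  "shortest_path V E u v P \<Longrightarrow> walk_between V E u v Q \<Longrightarrow> length P \<le> length Q"
  using gdist_le by (fastforce simp: shortest_path_def)

text \<open>By \<open>cross_walk\<close>, a walk no longer than either candidate contains all
  vertices of one of them, so it can avoid \<open>X\<close> only if that candidate does. The two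
  inequalities overlap: for equal lengths either candidate may serve.\<close>

lemma X_visible_cross:
  assumes ijk: "triple i j k" and s: "s \<in> SV m" and t: "t \<in> SV m"
    and X: "i # s \<in> X" "j # t \<in> X"
  shows "X_visible (SV (Suc m)) (SE (Suc m)) X (i # s) (j # t) \<longleftrightarrow>
      cdist j s + cdist i t \<le> cdist k s + cdist k t + 2 ^ m
        \<and> sees (slice i X) j s \<and> sees (slice j X) i t
    \<or> cdist k s + cdist k t + 2 ^ m \<le> cdist j s + cdist i t
        \<and> sees (slice i X) k s \<and> sees (slice j X) k t \<and> side i j m \<inter> slice k X = {}"
   (is "?vis \<longleftrightarrow> ?dir \<or> ?ind")
proof -
  have dist: "i \<noteq> j" "i \<noteq> k" "k \<noteq> j" "i < 3" "j < 3" "k < 3"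
    using ijk by (auto simp: triple_def)
  obtain P where P: "walk_between (SV (Suc m)) (SE (Suc m)) (i # s) (j # t) P"
     "length P = Suc (cdist j s + cdist i t + 1)" "set P \<subseteq> Cons i ` cpath j s \<union> Cons j ` cpath i t"
    using direct_walk_ex dist s t by metis
  obtain Q where Q: "walk_between (SV (Suc m)) (SE (Suc m)) (i # s) (j # t) Q"
     "length Q = Suc (cdist k s + cdist k t + 2 ^ m + 1)"
     "set Q \<subseteq> Cons i ` cpath k s \<union> Cons k ` side i j m \<union> Cons j ` cpath k t"
    using indirect_walk_ex[OF ijk s t] by metis
  note cr = cross_walk[OF ijk s t]
  have d: "(Cons i ` cpath j s \<union> Cons j ` cpath i t) \<inter> X \<subseteq> {i # s, j # t}
     \<longleftrightarrow> sees (slice i X) j s \<and> sees (slice j X) i t"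
    using dist by (auto simp: sees_def slice_def)
  have n: "(Cons i ` cpath k s \<union> Cons k ` side i j m \<union> Cons j ` cpath k t) \<inter> X \<subseteq> {i # s, j # t}
     \<longleftrightarrow> sees (slice i X) k s \<and> sees (slice j X) k t \<and> side i j m \<inter> slice k X = {}"
    using dist by (auto simp: sees_def slice_def)
  show ?thesis
  proof
    assume ?vis
    then obtain R where R: "shortest_path (SV (Suc m)) (SE (Suc m)) (i # s) (j # t) R"
      "set R \<inter> X \<subseteq> {i # s, j # t}"
      by (auto simp: X_visible_def)
    then have w: "walk_between (SV (Suc m)) (SE (Suc m)) (i # s) (j # t) R"
      by (simp add: shortest_path_def)
    have le: "length R \<le> length P" "length R \<le> length Q"
      using shortest_path_le[OF R(1) P(1)] shortest_path_le[OF R(1) Q(1)] by auto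
    show "?dir \<or> ?ind"
      using cr[OF w]
    proof (elim disjE conjE)
      assume a: "Cons i ` cpath j s \<union> Cons j ` cpath i t \<subseteq> set R"
        "Suc (cdist j s + cdist i t + 1) \<le> length R"
      then have "sees (slice i X) j s \<and> sees (slice j X) i t" using R(2) d by blast
      then show ?thesis using a le Q(2) by simp
    next
      assume a: "Cons i ` cpath k s \<union> Cons k ` side i j m \<union> Cons j ` cpath k t \<subseteq> set R"
        "Suc (cdist k s + cdist k t + 2 ^ m + 1) \<le> length R"
      then have "sees (slice i X) k s \<and> sees (slice j X) k t \<and> side i j m \<inter> slice k X = {}"
        using R(2) n by blast
      then show ?thesis using a le P(2) by simp
    qed (use le P Q in simp_all)
  next
    assume "?dir \<or> ?ind"
    then show ?vis
    proof
      assume a: ?dir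
      have "length P \<le> length R" if "walk_between (SV (Suc m)) (SE (Suc m)) (i # s) (j # t) R" for R
        using cr[OF that] a P(2) by linarith
      then have "shortest_path (SV (Suc m)) (SE (Suc m)) (i # s) (j # t) P"
        using P(1) by (blast intro: shortest_pathI)
      moreover have "set P \<inter> X \<subseteq> {i # s, j # t}" 
        using subset_trans[OF Int_mono[OF P(3) subset_refl]] d a by simp
      ultimately show ?vis by (auto simp: X_visible_def)
    next
      assume a: ?ind
      have "length Q \<le> length R" if "walk_between (SV (Suc m)) (SE (Suc m)) (i # s) (j # t) R" for R
        using cr[OF that] a Q(2) by linarith
      then have "shortest_path (SV (Suc m)) (SE (Suc m)) (i # s) (j # t) Q"
        using Q(1) by (blast intro: shortest_pathI)
      moreover have "set Q \<inter> X \<subseteq> {i # s, j # t}" 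
        using subset_trans[OF Int_mono[OF Q(3) subset_refl]] n a by simp
      ultimately show ?vis by (auto simp: X_visible_def)
    qed
  qed
qed

text \<open>An excursion returning through the corner where it left can be cut out. One returning
  through another corner has at least 2^m + 1 vertices between exit and return, whereas
  \<open>walk_ex_short\<close> joins \<open>s\<close> and \<open>t\<close> inside the copy with at
  most 2^m.\<close>

lemma short_walk_in_copy:
  assumes "i < 3" and s: "s \<in> SV m" and t: "t \<in> SV m"
    and P: "shortest_path (SV (Suc m)) (SE (Suc m)) (i # s) (i # t) P"
  shows "\<exists>P'. P = map (Cons i) P'"
proof (cases "\<exists>v\<in>set P. hd v \<noteq> i")
  case True
  have w: "is_walk (SV (Suc m)) (SE (Suc m)) P" "hd P = i # s" "last P = i # t"
    using P by (auto simp: walk_between_def shortest_path_def)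
  obtain P1 R e where R: "P = map (Cons i) P1 @ R" "R \<noteq> []"
    "walk_between (SV m) (SE m) s (replicate m e) P1" "hd R = e # replicate m i"
    "is_walk (SV (Suc m)) (SE (Suc m)) R" "e \<noteq> i" "e < 3"
    using walk_exit[OF w(1,2) True] by blast
  have lR: "last R = i # t" using R w by simp
  have "hd R \<in> set R" using R(2) by (rule hd_in_set)
  then have "\<exists>v\<in>set R. hd v \<noteq> i" using R by (metis list.sel(1))
  then obtain P4 Q e' where Q: "R = Q @ map (Cons i) P4" "Q \<noteq> []"
      "walk_between (SV m) (SE m) (replicate m e') t P4" "last Q = e' # replicate m i"
      "is_walk (SV (Suc m)) (SE (Suc m)) Q" "e' \<noteq> i" "e' < 3"
    using walk_entry[OF R(5) lR] by blast
  have l: "length P = length P1 + length Q + length P4" using R Q by simp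
  have hQ: "hd Q = e # replicate m i" using R(4) Q(1,2) by simp
  show ?thesis
  proof (cases "e = e'")
    case True
    obtain P5 where P4: "P4 = replicate m e' # P5"
      using Q(3) by (cases P4) (auto simp: walk_between_def)
    have "walk_between (SV m) (SE m) s t (P1 @ P5)"
    proof (cases P5)
      case Nil
      then show ?thesis using R(3) Q(3) P4 True by (simp add: walk_between_def)
    next
      case (Cons y P6)
      then have "walk_between (SV m) (SE m) y t P5" "SE m (replicate m e) y"
        using Q(3) P4 True by (auto simp: walk_between_def)
      then show ?thesis using R(3) by (blast intro: walk_between_append)
    qed
    then have "walk_between (SV (Suc m)) (SE (Suc m)) (i # s) (i # t) (map (Cons i) (P1 @ P5))"
      using assms by (subst walk_between_map_Cons)
    then have "length P \<le> length (P1 @ P5)"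
      using shortest_path_le[OF P] by fastforce
    then show ?thesis using l P4 Q(2) by simp
  next
    case False
    have "length Q \<ge> 2 ^ m + 1"
      using walk_cdist[OF Q(5), of e', unfolded hQ Q(4)] False Q(6) R(6)
      by (simp add: cdist_replicate)
    moreover obtain P' where P': "walk_between (SV m) (SE m) s t P'" "length P' \<le> 2 ^ m"
      using walk_ex_short[OF s t] by blast
    have "walk_between (SV (Suc m)) (SE (Suc m)) (i # s) (i # t) (map (Cons i) P')"
      using assms P' by (subst walk_between_map_Cons)
    then have "length P \<le> length P'"
      using shortest_path_le[OF P] by fastforce
    ultimately show ?thesis using P' l by linarith
  qed
next
  case False
  have "v = i # tl v" if "v \<in> set P" for v
  proof -
    have "v \<in> SV (Suc m)"
      using P that by (auto simp: shortest_path_def walk_between_def is_walk_def)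
    then show ?thesis using False that by (metis SV_SucE list.sel(1,3))
  qed
  then have "P = map (Cons i) (map tl P)" by (simp add: map_idI)
  then show ?thesis by blast
qed

lemma shortest_path_map_Cons:
  assumes "i < 3" and s: "s \<in> SV m" and t: "t \<in> SV m"
  shows "shortest_path (SV (Suc m)) (SE (Suc m)) (i # s) (i # t) (map (Cons i) P)
    \<longleftrightarrow> shortest_path (SV m) (SE m) s t P"
proof
  assume a: "shortest_path (SV (Suc m)) (SE (Suc m)) (i # s) (i # t) (map (Cons i) P)"
  show "shortest_path (SV m) (SE m) s t P"
  proof (rule shortest_pathI)
    show "walk_between (SV m) (SE m) s t P"
      using a assms by (simp add: shortest_path_def walk_between_map_Cons)
    show "length P \<le> length Q" if "walk_between (SV m) (SE m) s t Q" for Q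
      using shortest_path_le[OF a, of "map (Cons i) Q"] that assms
      by (simp add: walk_between_map_Cons)
  qed
next
  assume a: "shortest_path (SV m) (SE m) s t P"
  then have w: "walk_between (SV (Suc m)) (SE (Suc m)) (i # s) (i # t) (map (Cons i) P)"
    using assms by (simp add: shortest_path_def walk_between_map_Cons)
  then obtain k where "\<exists>Q. walk_between (SV (Suc m)) (SE (Suc m)) (i # s) (i # t) Q \<and> length Q = k"
    by blast
  then obtain Q where Q: "walk_between (SV (Suc m)) (SE (Suc m)) (i # s) (i # t) Q"
    "\<And>R. walk_between (SV (Suc m)) (SE (Suc m)) (i # s) (i # t) R \<Longrightarrow> length Q \<le> length R"
    using ex_has_least_nat[of "walk_between (SV (Suc m)) (SE (Suc m)) (i # s) (i # t)" _ length] w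
    by metis
  then have sQ: "shortest_path (SV (Suc m)) (SE (Suc m)) (i # s) (i # t) Q"
    by (rule shortest_pathI)
  then obtain Q' where Q': "Q = map (Cons i) Q'"
    using short_walk_in_copy[OF assms] by blast
  then have "walk_between (SV m) (SE m) s t Q'"
    using Q(1) assms by (simp add: walk_between_map_Cons)
  then have "length P \<le> length Q'" using shortest_path_le[OF a] by blast
  then have "length (map (Cons i) P) \<le> length Q" using Q' by simp
  then have "\<And>R. walk_between (SV (Suc m)) (SE (Suc m)) (i # s) (i # t) R \<Longrightarrow> length (map (Cons i) P) \<le> length R"
    using Q(2) le_trans by blast
  then show "shortest_path (SV (Suc m)) (SE (Suc m)) (i # s) (i # t) (map (Cons i) P)"
    using w by (blast intro: shortest_pathI)
qed

lemma X_visible_copy: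
  assumes "i < 3" and s: "s \<in> SV m" and t: "t \<in> SV m"
  shows "X_visible (SV (Suc m)) (SE (Suc m)) X (i # s) (i # t) \<longleftrightarrow> X_visible (SV m) (SE m) (slice i X) s t"
proof -
  have e: "set (map (Cons i) P) \<inter> X \<subseteq> {i # s, i # t} \<longleftrightarrow> set P \<inter> slice i X \<subseteq> {s, t}" for P
    by (auto simp: slice_def)
  show ?thesis
    unfolding X_visible_def
    using short_walk_in_copy[OF assms] shortest_path_map_Cons[OF assms] e by metis
qed

text \<open>Vertices of different copies \<open>i\<close> and \<open>j\<close> admit only two candidate geodesics: one uses the edge
  joining the copies, the other runs along a whole side of the third copy \<open>k\<close>.\<close>

fun mv :: "nat \<Rightarrow> nat list set \<Rightarrow> bool" where
  "mv 0 X \<longleftrightarrow> True"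
| "mv (Suc m) X \<longleftrightarrow> (\<forall>a<3. mv m (slice a X)) \<and>
     (\<forall>i j k. triple i j k \<longrightarrow> (\<forall>s\<in>slice i X. \<forall>t\<in>slice j X.
        cdist j s + cdist i t \<le> cdist k s + cdist k t + 2 ^ m
          \<and> sees (slice i X) j s \<and> sees (slice j X) i t
      \<or> cdist k s + cdist k t + 2 ^ m \<le> cdist j s + cdist i t
          \<and> sees (slice i X) k s \<and> sees (slice j X) k t \<and> side i j m \<inter> slice k X = {}))"

lemma slice_SV: "X \<subseteq> SV (Suc m) \<Longrightarrow> slice a X \<subseteq> SV m"
  by (auto simp: slice_def)

lemma mutual_visibility_set_iff_mv:
  "mutual_visibility_set (SV n) (SE n) X \<longleftrightarrow> X \<subseteq> SV n \<and> mv n X"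
proof (induction n arbitrary: X)
  case 0
  have "walk_between (SV 0) (SE 0) [] [] [[]]" by (simp add: walk_between_def)
  moreover have "length P \<ge> 1" if "walk_between (SV 0) (SE 0) [] [] P" for P
    using that by (cases P) (auto simp: walk_between_def)
  ultimately have "shortest_path (SV 0) (SE 0) [] [] [[]]"
    by (intro shortest_pathI) auto
  then have "X_visible (SV 0) (SE 0) X [] []" by (auto simp: X_visible_def)
  then show ?case by (auto simp: mutual_visibility_set_def)
next
  case (Suc m)
  show ?case
  proof (cases "X \<subseteq> SV (Suc m)")
    case True
    have slice: "a < 3" "s \<in> SV m" if "s \<in> slice a X" for a s
      using that True by (auto simp: slice_def)
    have "(\<forall>u\<in>X. \<forall>v\<in>X. X_visible (SV (Suc m)) (SE (Suc m)) X u v) \<longleftrightarrow>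
       (\<forall>a b s t. s \<in> slice a X \<longrightarrow> t \<in> slice b X \<longrightarrow> X_visible (SV (Suc m)) (SE (Suc m)) X (a # s) (b # t))"
      (is "_ \<longleftrightarrow> ?all")
      using True unfolding slice_def by (smt (verit) SV_SucE mem_Collect_eq subsetD)
    also have "?all \<longleftrightarrow> (\<forall>a<3. \<forall>s\<in>slice a X. \<forall>t\<in>slice a X. X_visible (SV (Suc m)) (SE (Suc m)) X (a # s) (a # t))
       \<and> (\<forall>i j k. triple i j k \<longrightarrow> (\<forall>s\<in>slice i X. \<forall>t\<in>slice j X. X_visible (SV (Suc m)) (SE (Suc m)) X (i # s) (j # t)))"
      (is "_ \<longleftrightarrow> ?A \<and> ?B")
    proof
      assume "?A \<and> ?B"
      then have A: ?A and B: ?B by auto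
      show ?all
      proof (intro allI impI)
        fix a b s t assume st: "s \<in> slice a X" "t \<in> slice b X"
        show "X_visible (SV (Suc m)) (SE (Suc m)) X (a # s) (b # t)"
        proof (cases "a = b")
          case True
          then show ?thesis using A st slice by blast
        next
          case False
          then obtain k where "triple a b k" using triple_ex slice st by metis
          then show ?thesis using B st by blast
        qed
      qed
    qed blast
    also have "?A \<longleftrightarrow> (\<forall>a<3. mv m (slice a X))"
    proof -
      have "(\<forall>s\<in>slice a X. \<forall>t\<in>slice a X. X_visible (SV (Suc m)) (SE (Suc m)) X (a # s) (a # t))
        \<longleftrightarrow> mutual_visibility_set (SV m) (SE m) (slice a X)" if "a < 3" for a
        using X_visible_copy[OF that] slice(2) slice_SV[OF True, of a]
        unfolding mutual_visibility_set_def by blast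
      then show ?thesis using Suc.IH slice_SV[OF True] by simp
    qed
    also have "?B \<longleftrightarrow> (\<forall>i j k. triple i j k \<longrightarrow> (\<forall>s\<in>slice i X. \<forall>t\<in>slice j X.
        cdist j s + cdist i t \<le> cdist k s + cdist k t + 2 ^ m
          \<and> sees (slice i X) j s \<and> sees (slice j X) i t
      \<or> cdist k s + cdist k t + 2 ^ m \<le> cdist j s + cdist i t
          \<and> sees (slice i X) k s \<and> sees (slice j X) k t \<and> side i j m \<inter> slice k X = {}))"
    proof -
      have "X_visible (SV (Suc m)) (SE (Suc m)) X (i # s) (j # t) \<longleftrightarrow>
         cdist j s + cdist i t \<le> cdist k s + cdist k t + 2 ^ m
          \<and> sees (slice i X) j s \<and> sees (slice j X) i t
        \<or> cdist k s + cdist k t + 2 ^ m \<le> cdist j s + cdist i t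
          \<and> sees (slice i X) k s \<and> sees (slice j X) k t \<and> side i j m \<inter> slice k X = {}"
        if "triple i j k" "s \<in> slice i X" "t \<in> slice j X" for i j k s t
        using that slice by (intro X_visible_cross) (auto simp: slice_def)
      then show ?thesis by (smt (verit, ccfv_threshold))
    qed
    finally show ?thesis using True by (simp add: mutual_visibility_set_def)
  qed (simp add: mutual_visibility_set_def)
qed

section \<open>Large mutual-visibility sets\<close>

definition open_to :: "nat list set \<Rightarrow> nat \<Rightarrow> bool" where
  "open_to X j \<longleftrightarrow> (\<forall>s\<in>X. sees X j s)"

lemma slice_mono: "X \<subseteq> Y \<Longrightarrow> slice a X \<subseteq> slice a Y"
  by (auto simp: slice_def)

lemma slice_Un [simp]: "slice a (X \<union> Y) = slice a X \<union> slice a Y"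
  by (auto simp: slice_def)

lemma mem_slice [simp]: "s \<in> slice a X \<longleftrightarrow> a # s \<in> X"
  by (simp add: slice_def)

lemma sees_mono: "sees Y j s \<Longrightarrow> X \<subseteq> Y \<Longrightarrow> sees X j s"
  by (auto simp: sees_def)

lemma mv_mono: "mv m Y \<Longrightarrow> X \<subseteq> Y \<Longrightarrow> mv m X"
proof (induction m arbitrary: X Y)
  case (Suc m)
  have s: "slice a X \<subseteq> slice a Y" for a using Suc.prems slice_mono by blast
  have "mv m (slice a X)" if "a < 3" for a
    using Suc that s by auto
  moreover have "cdist j u + cdist i v \<le> cdist k u + cdist k v + 2 ^ m
          \<and> sees (slice i X) j u \<and> sees (slice j X) i v
      \<or> cdist k u + cdist k v + 2 ^ m \<le> cdist j u + cdist i v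
          \<and> sees (slice i X) k u \<and> sees (slice j X) k v \<and> side i j m \<inter> slice k X = {}"
    if "triple i j k" "u \<in> slice i X" "v \<in> slice j X" for i j k u v
  proof -
    have "u \<in> slice i Y" "v \<in> slice j Y" using that s by blast+
    then have "cdist j u + cdist i v \<le> cdist k u + cdist k v + 2 ^ m
          \<and> sees (slice i Y) j u \<and> sees (slice j Y) i v
      \<or> cdist k u + cdist k v + 2 ^ m \<le> cdist j u + cdist i v
          \<and> sees (slice i Y) k u \<and> sees (slice j Y) k v \<and> side i j m \<inter> slice k Y = {}"
      using Suc.prems(1) that(1) unfolding mv.simps by blast
    then show ?thesis using sees_mono[OF _ s] s[of k] by blast
  qed
  ultimately show ?case by auto
qed simp

section \<open>Explicit sets attaining the bound\<close>

lemma all_triple: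
  "(\<forall>i j k. triple i j k \<longrightarrow> P i j k) \<longleftrightarrow>
     P 0 1 2 \<and> P 0 2 1 \<and> P 1 0 2 \<and> P 1 2 0 \<and> P 2 0 1 \<and> P 2 1 0"
proof
  assume "\<forall>i j k. triple i j k \<longrightarrow> P i j k"
  then show "P 0 1 2 \<and> P 0 2 1 \<and> P 1 0 2 \<and> P 1 2 0 \<and> P 2 0 1 \<and> P 2 1 0"
    by (simp add: triple_def)
next
  have "triple i j k \<Longrightarrow> (i, j, k) \<in> {(0,1,2),(0,2,1),(1,0,2),(1,2,0),(2,0,1),(2,1,0)}" for i j k
    by (auto simp: triple_def less_Suc_eq numeral_3_eq_3 numeral_2_eq_2)
  then show "P 0 1 2 \<and> P 0 2 1 \<and> P 1 0 2 \<and> P 1 2 0 \<and> P 2 0 1 \<and> P 2 1 0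
    \<Longrightarrow> \<forall>i j k. triple i j k \<longrightarrow> P i j k"
    by fastforce
qed

lemma all_less_3: "(\<forall>a<3. P a) \<longleftrightarrow> P 0 \<and> P 1 \<and> P (2::nat)"
  by (auto simp: less_Suc_eq numeral_3_eq_3 numeral_2_eq_2)

lemma slice_insert: "slice a (insert v X) = (if v \<noteq> [] \<and> hd v = a then insert (tl v) (slice a X) else slice a X)"
  by (cases v) (auto simp: slice_def)

lemma slice_empty [simp]: "slice a {} = {}"
  by (auto simp: slice_def)

text \<open>Order two needs an example of its own, because \<open>inner\<close> is empty below order
  three.\<close>

lemma mv_four: "mv (Suc (Suc 0)) {[0, 0], [0, 1], [2, 1], [2, 2]}"
  by (simp add: all_triple all_less_3 slice_insert sees_def side_Suc del: mem_slice)

text \<open>The words \<open>w a b c\<close> with \<open>(a, b, c)\<close> a rotation of \<open>(0, 1, 2)\<close>: inner vertices of the side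
  of an \<open>S\<^sub>3\<^sup>2\<close> opposite to its exit, which no geodesic between distant vertices traverses.\<close>

fun inner :: "nat \<Rightarrow> nat list set" where
  "inner 0 = {}"
| "inner (Suc m) = (if m = 2 then {[0, 1, 2], [1, 2, 0], [2, 0, 1]}
     else (\<Union>a<3. Cons a ` inner m))"

definition corners :: "nat \<Rightarrow> nat list set" where
  "corners n = (\<lambda>a. replicate n a) ` {..<3}"

lemma corners_SV: "corners n \<subseteq> SV n"
  by (auto simp: corners_def)

lemma slice_inner: "n \<ge> 3 \<Longrightarrow> a < 3 \<Longrightarrow> slice a (inner (Suc n)) = inner n"
  by (auto simp: slice_def)

lemma slice_corners: "a < 3 \<Longrightarrow> slice a (corners (Suc n)) = {replicate n a}"
  by (auto simp: slice_def corners_def)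

lemma inner_3: "inner 3 = {[0, 1, 2], [1, 2, 0], [2, 0, 1]}"
  by (simp add: eval_nat_numeral)

lemma inner_SV: "inner n \<subseteq> SV n"
proof (induction n)
  case (Suc n)
  show ?case
  proof (cases "n = 2")
    case True
    then show ?thesis using inner_3 by (simp add: sierp_V_def)
  next
    case False
    then show ?thesis using Suc by auto
  qed
qed simp

lemma corners_3: "corners 3 = {[0, 0, 0], [1, 1, 1], [2, 2, 2]}"
  by (auto simp: corners_def eval_nat_numeral less_Suc_eq)

text \<open>Words of \<open>inner n\<close> end in a rotation of 0 1 2 and so use three letters;
  words of a side use at most two.\<close>

lemma side_inner: "n \<ge> 3 \<Longrightarrow> side i j n \<inter> inner n = {}"
proof (induction n rule: dec_induct)
  case base
  then show ?case by (auto simp: inner_3 side_def)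
next
  case (step n)
  then show ?case by (auto simp: disjoint_iff)
qed

text \<open>Within the own copy the geodesic is clear by induction, and its remainder is a side of
  copy \<open>j\<close>, clear by \<open>side_inner\<close>.\<close>

lemma inner_sees: "n \<ge> 3 \<Longrightarrow> s \<in> inner n \<Longrightarrow> j < 3 \<Longrightarrow> sees (inner n) j s"
proof (induction n arbitrary: s rule: dec_induct)
  case base
  have "s \<in> {[0, 1, 2], [1, 2, 0], [2, 0, 1]}" "j = 0 \<or> j = 1 \<or> j = 2"
    using base by (auto simp only: inner_3)
  then show ?case
    unfolding sees_def inner_3
    by (elim disjE insertE emptyE) (simp_all add: side_Suc)
next
  case (step n)
  then obtain a s' where s: "s = a # s'" "a < 3" "s' \<in> inner n" by auto
  then have l: "length s' = n" using inner_SV SV_length by blast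
  have "sees (inner n) j s'" using step s by blast
  then show ?case
    using s l step side_inner[of n a j] by (auto simp: sees_def split: if_splits)
qed

lemma replicate_in_cpath: "replicate (length s) i \<in> cpath j s \<Longrightarrow> i = j \<or> s = replicate (length s) i"
  by (induction s) (auto simp: Cons_replicate_eq split: if_splits)

text \<open>The added corner \<open>i\<close> can lie on a geodesic to another corner
  \<open>j\<close> only as its start.\<close>

lemma inner_corner_sees:
  assumes n: "n \<ge> 3" and ij: "i < 3" "j < 3" "i \<noteq> j" and s: "s \<in> inner n \<union> {replicate n i}"
  shows "sees (inner n \<union> {replicate n i}) j s"
proof (cases "s = replicate n i")
  case True
  then show ?thesis using side_inner[OF n, of i j] by (auto simp: sees_def cpath_replicate)
next
  case False
  then have s: "s \<in> inner n" using s by auto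
  then have l: "length s = n" using inner_SV SV_length by blast
  then show ?thesis
    using inner_sees[OF n s ij(2)] replicate_in_cpath[of s i j] False ij by (auto simp: sees_def)
qed

text \<open>In copy \<open>a\<close> only the outward corner \<open>a\<close> is added to
  \<open>inner n\<close>, so all gates stay visible and all sides needed for detours are clear. Both
  candidate geodesics are therefore free of obstacles, and it does not matter which one is
  shorter.\<close>

lemma mv_inner_corners: "n \<ge> 3 \<Longrightarrow> mv n (inner n \<union> corners n)"
proof (induction n rule: dec_induct)
  case base
  have "mv (Suc (Suc (Suc 0))) {[0, 1, 2], [1, 2, 0], [2, 0, 1], [0, 0, 0], [1, 1, 1], [2, 2, 2]}"
    by (simp add: all_triple all_less_3 slice_insert sees_def side_Suc del: mem_slice)
  then have "mv 3 {[0, 1, 2], [1, 2, 0], [2, 0, 1], [0, 0, 0], [1, 1, 1], [2, 2, 2]}"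
    by (simp only: numeral_3_eq_3)
  then show ?case by (simp add: inner_3 corners_3 insert_commute del: mv.simps)
next
  case (step n)
  have slice: "slice a (inner (Suc n) \<union> corners (Suc n)) = inner n \<union> {replicate n a}" if "a < 3" for a
    using that step by (simp only: slice_Un slice_inner slice_corners)
  have "mv n (inner n \<union> {replicate n a})" if "a < 3" for a
    by (rule mv_mono[OF step.IH]) (use that in \<open>auto simp: corners_def\<close>)
  moreover have cross:
    "cdist j u + cdist i v \<le> cdist k u + cdist k v + 2 ^ n
          \<and> sees (inner n \<union> {replicate n i}) j u \<and> sees (inner n \<union> {replicate n j}) i v
      \<or> cdist k u + cdist k v + 2 ^ n \<le> cdist j u + cdist i v
          \<and> sees (inner n \<union> {replicate n i}) k u \<and> sees (inner n \<union> {replicate n j}) k v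
          \<and> side i j n \<inter> (inner n \<union> {replicate n k}) = {}"
    if t: "triple i j k" and u: "u \<in> inner n \<union> {replicate n i}" and v: "v \<in> inner n \<union> {replicate n j}"
    for i j k u v
  proof -
    have d: "i \<noteq> j" "i \<noteq> k" "j \<noteq> k" "i < 3" "j < 3" "k < 3" using t by (auto simp: triple_def)
    have "replicate n k \<notin> side i j n" using d step.hyps by (auto simp: side_def)
    then have "side i j n \<inter> (inner n \<union> {replicate n k}) = {}"
      using side_inner[of n i j] step.hyps by auto
    moreover have "sees (inner n \<union> {replicate n i}) j u" "sees (inner n \<union> {replicate n i}) k u"
      "sees (inner n \<union> {replicate n j}) i v" "sees (inner n \<union> {replicate n j}) k v"
      using inner_corner_sees step.hyps d u v by metis+
    ultimately show ?thesis using linear by blast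
  qed
  ultimately show ?case
    unfolding mv.simps
  proof (intro conjI allI impI ballI)
    fix i j k u v
    assume *: "triple i j k" "u \<in> slice i (inner (Suc n) \<union> corners (Suc n))"
      "v \<in> slice j (inner (Suc n) \<union> corners (Suc n))"
    have "i < 3" "j < 3" "k < 3" using * by (auto simp: triple_def)
    then show "cdist j u + cdist i v \<le> cdist k u + cdist k v + 2 ^ n
          \<and> sees (slice i (inner (Suc n) \<union> corners (Suc n))) j u
          \<and> sees (slice j (inner (Suc n) \<union> corners (Suc n))) i v
      \<or> cdist k u + cdist k v + 2 ^ n \<le> cdist j u + cdist i v
          \<and> sees (slice i (inner (Suc n) \<union> corners (Suc n))) k u
          \<and> sees (slice j (inner (Suc n) \<union> corners (Suc n))) k v
          \<and> side i j n \<inter> slice k (inner (Suc n) \<union> corners (Suc n)) = {}"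
      using cross[of i j k u v] * by (simp only: slice)
  qed (simp only: slice)
qed

lemma card_inner: "n \<ge> 3 \<Longrightarrow> card (inner n) = 3 ^ (n - 2)"
proof (induction n rule: dec_induct)
  case base
  then show ?case by (simp add: inner_3)
next
  case (step n)
  have fin: "finite (inner n)" by (rule card_ge_0_finite) (simp add: step)
  have "card (inner (Suc n)) = (\<Sum>a<3. card (Cons a ` inner n))"
    using step fin by (simp del: card_image) (subst card_UN_disjoint; auto)
  also have "\<dots> = 3 * 3 ^ (n - 2)" using step by (simp add: card_image)
  also have "\<dots> = 3 ^ (Suc n - 2)"
    using step.hyps power_Suc[of "3::nat" "n - 2"] by (simp add: Suc_diff_Suc numeral_2_eq_2)
  finally show ?case .
qed

lemma card_inner_corners:
  assumes "n \<ge> 3"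
  shows "card (inner n \<union> corners n) = 3 ^ (n - 2) + 3"
proof -
  have "inj_on (\<lambda>a. replicate n a) {..<3::nat}"
    using assms by (auto intro!: inj_onI)
  then have "card (corners n) = 3" by (simp add: corners_def card_image)
  moreover have "inner n \<inter> corners n = {}"
  proof -
    have "replicate n a \<notin> inner n" for a
      using side_inner[OF assms, of a a] replicate_in_side(1)[of n a a] by blast
    then show ?thesis by (auto simp: corners_def)
  qed
  moreover have "finite (inner n)" "finite (corners n)"
    using card_inner[OF assms] by (auto intro: card_ge_0_finite simp: corners_def)
  ultimately show ?thesis by (simp add: card_Un_disjoint card_inner[OF assms])
qed

lemma mutual_visibility_lower:
  assumes "n \<ge> 2"
  shows "\<exists>X. mutual_visibility_set (SV n) (SE n) X \<and> card X = 3 ^ (n - 2) + 3"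
proof (cases "n = 2")
  case True
  have "{[0, 0], [0, 1], [2, 1], [2, 2]} \<subseteq> SV 2" by (auto simp: sierp_V_def)
  then show ?thesis
    using True mv_four unfolding mutual_visibility_set_iff_mv
    by (intro exI[of _ "{[0, 0], [0, 1], [2, 1], [2, 2]}"]) (simp add: numeral_2_eq_2)
next
  case False
  then have "n \<ge> 3" using assms by simp
  then show ?thesis
    using mv_inner_corners card_inner_corners inner_SV corners_SV
    unfolding mutual_visibility_set_iff_mv by (intro exI[of _ "inner n \<union> corners n"]) auto
qed

section \<open>Corners hidden by the set\<close>

lemma finite_SV [simp]: "finite (SV n)"
  using finite_lists_length_eq[of "{..<3::nat}" n] by (simp add: sierp_V_def conj_commute)

lemma SV_finite: "X \<subseteq> SV n \<Longrightarrow> finite X"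
  using finite_subset[of X "SV n"] by simp

lemma triple_perm: "triple i j k \<Longrightarrow> triple i k j" "triple i j k \<Longrightarrow> triple j i k"
  "triple i j k \<Longrightarrow> triple j k i" "triple i j k \<Longrightarrow> triple k i j" "triple i j k \<Longrightarrow> triple k j i"
  by (auto simp: triple_def)

lemma card_eq_sum_slice:
  assumes t: "triple i j k" and X: "X \<subseteq> SV (Suc m)"
  shows "card X = card (slice i X) + card (slice j X) + card (slice k X)"
proof -
  have "X = Cons i ` slice i X \<union> Cons j ` slice j X \<union> Cons k ` slice k X"
  proof (intro set_eqI iffI)
    fix v assume v: "v \<in> X"
    then obtain a s where "v = a # s" "a < 3" using X SV_SucE by blast
    then show "v \<in> Cons i ` slice i X \<union> Cons j ` slice j X \<union> Cons k ` slice k X"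
      using v triple_less[OF t, of a] by auto
  qed auto
  then have "card X = card (Cons i ` slice i X \<union> Cons j ` slice j X \<union> Cons k ` slice k X)" by simp
  also have "\<dots> = card (Cons i ` slice i X) + card (Cons j ` slice j X) + card (Cons k ` slice k X)"
    using t SV_finite[OF slice_SV[OF X]]
    by (subst card_Un_disjoint; (subst card_Un_disjoint)?) (auto simp: triple_def)
  finally show ?thesis by (simp add: card_image)
qed

lemma mv_cross:
  assumes "mv (Suc m) X" "triple i j k" "s \<in> slice i X" "t \<in> slice j X"
  shows "cdist j s + cdist i t \<le> cdist k s + cdist k t + 2 ^ m
          \<and> sees (slice i X) j s \<and> sees (slice j X) i t
      \<or> cdist k s + cdist k t + 2 ^ m \<le> cdist j s + cdist i t
          \<and> sees (slice i X) k s \<and> sees (slice j X) k t \<and> side i j m \<inter> slice k X = {}"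
  using assms unfolding mv.simps by blast

lemma sees_Cons:
  assumes "length s = m"
  shows "sees X j (a # s) \<longleftrightarrow> sees (slice a X) j s \<and> (a \<noteq> j \<longrightarrow> side a j m \<inter> slice j X = {})"
  using assms by (auto simp: sees_def)

lemma open_to_slice:
  assumes "X \<subseteq> SV (Suc m)" "open_to X j"
  shows "open_to (slice a X) j"
  unfolding open_to_def
proof
  fix s assume "s \<in> slice a X"
  moreover from this have "length s = m" using slice_SV[OF assms(1)] SV_length by blast
  ultimately show "sees (slice a X) j s"
    using assms(2) sees_Cons[of s m X j a] by (simp add: open_to_def)
qed

text \<open>Vertices of copy \<open>a\<close> enter copy \<open>j\<close> at its corner
  \<open>a\<close> and follow the whole side to corner \<open>j\<close>.\<close>

lemma open_to_side:
  assumes "X \<subseteq> SV (Suc m)" "open_to X j" "slice a X \<noteq> {}" "a \<noteq> j"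
  shows "side a j m \<inter> slice j X = {}"
proof -
  obtain s where s: "s \<in> slice a X" using assms(3) by blast
  then have "length s = m" using slice_SV[OF assms(1)] SV_length by blast
  then show ?thesis using assms(2,4) s sees_Cons[of s m X j a] by (simp add: open_to_def)
qed

lemma slice_side:
  assumes "side a b (Suc m) \<inter> X = {}" "c = a \<or> c = b"
  shows "side a b m \<inter> slice c X = {}"
  using assms by (auto simp: disjoint_iff)

lemma near_imp:
  assumes "length s = m" "cdist k s + cdist k t + 2 ^ m \<le> cdist j s + cdist i t"
  shows "cdist k t < cdist i t"
  using assms cdist_less[of j s] by simp

text \<open>A vertex of copy \<open>i\<close> that cannot leave through corner \<open>j\<close> reaches all of copy \<open>j\<close> through copy \<open>k\<close>;
  such a detour is geodesic only if every vertex of copy \<open>j\<close> in the set is closer to \<open>k\<close> than to \<open>i\<close>.\<close>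

lemma hidden_corner:
  assumes mv: "mv (Suc m) X" and X: "X \<subseteq> SV (Suc m)" and t: "triple i j k"
    and s: "s \<in> slice i X" "\<not> sees (slice i X) j s"
  shows "open_to (slice j X) k"
    and "t \<in> slice j X \<Longrightarrow> cdist k s + cdist k t + 2 ^ m \<le> cdist j s + cdist i t"
    and "t \<in> slice j X \<Longrightarrow> cdist k t < cdist i t"
    and "t \<in> slice j X \<Longrightarrow> cdist k s < cdist j s"
    and "slice j X \<noteq> {} \<Longrightarrow> side i j m \<inter> slice k X = {}"
    and "slice j X \<noteq> {} \<Longrightarrow> sees (slice i X) k s"
proof -
  note c = mv_cross[OF mv t s(1)]
  have sl: "length s = m" "\<And>t. t \<in> slice j X \<Longrightarrow> length t = m"
    using s slice_SV[OF X] SV_length by blast+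
  show d: "cdist k s + cdist k t + 2 ^ m \<le> cdist j s + cdist i t" if "t \<in> slice j X" for t
    using c[OF that] s by blast
  show "open_to (slice j X) k" using c s by (auto simp: open_to_def)
  show "cdist k t < cdist i t" if "t \<in> slice j X"
    using near_imp[OF sl(1) d[OF that]] .
  show "cdist k s < cdist j s" if "t \<in> slice j X"
    using near_imp[of t m k s i j] sl(2)[OF that] d[OF that] by linarith
  show "side i j m \<inter> slice k X = {}" "sees (slice i X) k s" if "slice j X \<noteq> {}"
    using c s that by blast+
qed

section \<open>Sets in the graph of order two\<close>

definition ind :: "bool \<Rightarrow> nat" where "ind b = (if b then 1 else 0)"

lemma card_row_2:
  assumes t: "triple i j k" and X: "X \<subseteq> SV 2"
  shows "card (slice a X) = ind ([a, i] \<in> X) + ind ([a, j] \<in> X) + ind ([a, k] \<in> X)"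
proof -
  have "slice a X \<subseteq> SV (Suc 0)" using X by (intro slice_SV) (simp add: numeral_2_eq_2)
  moreover have "card A = ind ([] \<in> A)" if "A \<subseteq> SV 0" for A
    using that by (auto simp: ind_def subset_singleton_iff)
  ultimately show ?thesis
    using card_eq_sum_slice[OF t, of "slice a X" 0] slice_SV[of "slice a X" 0] by simp
qed

lemma card_2_rows:
  assumes t: "triple i j k" and X: "X \<subseteq> SV 2"
  shows "card X = card (slice i X) + card (slice j X) + card (slice k X)"
  using card_eq_sum_slice[OF t, of X 1] X by (simp add: numeral_2_eq_2)

lemma open_to_2:
  assumes "open_to X k" "X \<subseteq> SV 2"
  shows "[k, b] \<in> X \<Longrightarrow> b \<noteq> k \<Longrightarrow> [k, k] \<notin> X"
    and "[a, b] \<in> X \<Longrightarrow> a \<noteq> k \<Longrightarrow> [k, k] \<notin> X \<and> [k, a] \<notin> X"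
    and "[a, b] \<in> X \<Longrightarrow> a \<noteq> k \<Longrightarrow> b \<noteq> k \<Longrightarrow> [a, k] \<notin> X"
  using assms(1) unfolding open_to_def sees_def by (fastforce simp: side_Suc)+

text \<open>For one-letter words the detour inequality reads x + y + 2 <= x' + y' with all four
  values at most 1. So x = y = 0, and both ends are the vertices next to row
  \<open>k\<close>.\<close>

lemma mv_2:
  assumes "mv 2 X" "triple i j k" "[i, a] \<in> X" "[j, b] \<in> X"
  shows "(a \<noteq> j \<longrightarrow> [i, j] \<notin> X) \<and> (b \<noteq> i \<longrightarrow> [j, i] \<notin> X)
    \<or> a = k \<and> b = k \<and> [k, i] \<notin> X \<and> [k, j] \<notin> X"
proof -
  have m: "mv (Suc (Suc 0)) X" using assms(1) by (simp only: numeral_2_eq_2)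
  show ?thesis
    using mv_cross[OF m assms(2), of "[a]" "[b]"] assms(2-)
    by (auto simp: sees_def side_Suc triple_def split: if_splits)
qed

text \<open>\<open>[i, j]\<close> blocks the direct way from \<open>[i, i]\<close> to row
  \<open>j\<close>, and a detour would have to start at \<open>[i, k]\<close>.\<close>

lemma mv_2_row:
  assumes "mv 2 X" "triple i j k" "[i, i] \<in> X" "[i, j] \<in> X"
  shows "[j, b] \<notin> X"
  using mv_2[OF assms(1,2,3), of b] assms(2,4) by (auto simp: triple_def)

lemma mv_2_row2:
  assumes "mv 2 X" "triple i j k" "[i, k] \<in> X" "[i, j] \<in> X" "[j, b] \<in> X"
  shows "b = k" "[k, i] \<notin> X" "[k, j] \<notin> X"
  using mv_2[OF assms(1,2,3,5)] assms(2,4) by (auto simp: triple_def)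

text \<open>The delicate case is \<open>[i, j]\<close> and \<open>[i, k]\<close> in
  \<open>X\<close>: each forces the other to detour. If both further rows were inhabited, they would
  contain \<open>[j, k]\<close> and \<open>[k, j]\<close>, which lie on these detours.\<close>

lemma card_row_ge_2:
  assumes t: "triple i j k" and X: "X \<subseteq> SV 2" and mv: "mv 2 X" and c: "card (slice i X) \<ge> 2"
  shows "card (slice j X) = 0 \<or> card (slice k X) = 0"
proof -
  note r = card_row_2[OF t X]
  note tp = triple_perm[OF t]
  consider "[i, i] \<in> X" "[i, j] \<in> X" | "[i, i] \<in> X" "[i, k] \<in> X" | "[i, j] \<in> X" "[i, k] \<in> X"
    using c unfolding r by (auto simp: ind_def split: if_splits)
  then show ?thesis
  proof cases
    case 1
    then show ?thesis using mv_2_row[OF mv t] unfolding r by (simp add: ind_def)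
  next
    case 2
    then show ?thesis using mv_2_row[OF mv tp(1)] unfolding r by (simp add: ind_def)
  next
    case 3
    have "[j, b] \<in> X \<Longrightarrow> [k, c] \<notin> X" for b c
      using mv_2_row2[OF mv t 3(2,1)] mv_2_row2[OF mv tp(1) 3] by metis
    then show ?thesis unfolding r by (auto simp: ind_def)
  qed
qed

text \<open>Three vertices in a row empty both other rows and two empty one of them; the rest is
  arithmetic on the row sizes.\<close>

lemma card_2_free:
  assumes t: "triple i j k" and X: "X \<subseteq> SV 2" and mv: "mv 2 X"
  shows "card X \<le> 4"
proof -
  note tp = triple_perm[OF t]
  have 3: "card (slice b X) = 0 \<and> card (slice c X) = 0" if "triple a b c" "card (slice a X) \<ge> 3" for a b c
  proof -
    have "[a, a] \<in> X" "[a, b] \<in> X" "[a, c] \<in> X"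
      using that(2) unfolding card_row_2[OF that(1) X] by (auto simp: ind_def split: if_splits)
    then show ?thesis
      using mv_2_row[OF mv that(1)] mv_2_row[OF mv triple_perm(1)[OF that(1)]]
      unfolding card_row_2[OF that(1) X] by (simp add: ind_def)
  qed
  have le: "card (slice a X) \<le> 3" for a
    unfolding card_row_2[OF t X] by (simp add: ind_def)
  have arith: "a + b + c \<le> 4"
    if "a \<ge> 3 \<Longrightarrow> b = 0 \<and> c = 0" "b \<ge> 3 \<Longrightarrow> a = 0 \<and> c = 0" "c \<ge> 3 \<Longrightarrow> a = 0 \<and> b = 0"
      "a \<ge> 2 \<Longrightarrow> b = 0 \<or> c = 0" "b \<ge> 2 \<Longrightarrow> a = 0 \<or> c = 0" "c \<ge> 2 \<Longrightarrow> a = 0 \<or> b = 0"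
      "a \<le> 3" "b \<le> 3" "c \<le> 3" for a b c :: nat
  proof -
    consider "a \<ge> 3" | "b \<ge> 3" | "c \<ge> 3" | "a = 2" "b \<le> 2" "c \<le> 2" | "a \<le> 2" "b = 2" "c \<le> 2"
      | "a \<le> 2" "b \<le> 2" "c = 2" | "a \<le> 1" "b \<le> 1" "c \<le> 1" by linarith
    then show ?thesis
    proof cases
      case 1
      then show ?thesis using that(1)[OF 1] that(7) by linarith
    next
      case 2
      then show ?thesis using that(2)[OF 2] that(8) by linarith
    next
      case 3
      then show ?thesis using that(3)[OF 3] that(9) by linarith
    next
      case 4
      then show ?thesis using that(4) by linarith
    next
      case 5
      then show ?thesis using that(5) by linarith
    next
      case 6
      then show ?thesis using that(6) by linarith
    qed linarith
  qed
  show ?thesis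
    unfolding card_2_rows[OF t X]
    by (rule arith[OF 3[OF t] 3[OF tp(2)] 3[OF tp(4)] card_row_ge_2[OF t X mv]
      card_row_ge_2[OF tp(2) X mv] card_row_ge_2[OF tp(4) X mv] le le le])
qed

text \<open>A vertex of a row \<open>a\<close> other than \<open>k\<close> passes
  \<open>[k, a]\<close> and \<open>[k, k]\<close>, so these are free. Two vertices in row
  \<open>a\<close> cannot include \<open>[a, k]\<close>, hence are the pair of
  \<open>mv_2_row\<close>, and the other outer row is empty.\<close>

lemma card_2_open1:
  assumes t: "triple i j k" and X: "X \<subseteq> SV 2" and mv: "mv 2 X" and k: "open_to X k"
  shows "card X \<le> 3"
proof -
  note tp = triple_perm[OF t]
  have d: "i \<noteq> j" "i \<noteq> k" "j \<noteq> k" "j \<noteq> i" "k \<noteq> i" "k \<noteq> j" using t by (auto simp: triple_def)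
  note o = open_to_2[OF k X]
  note r = card_row_2[OF t X]
  have outer: "card (slice a X) \<le> 2 \<and> (card (slice a X) \<ge> 1 \<longrightarrow> [k, a] \<notin> X \<and> [k, k] \<notin> X)
     \<and> (card (slice a X) \<ge> 2 \<longrightarrow> card (slice b X) = 0)" if "triple a b k" for a b
  proof -
    have "a = i \<and> b = j \<or> a = j \<and> b = i" using that t by (auto simp: triple_def less_Suc_eq numeral_3_eq_3)
    moreover have "[a, k] \<in> X \<Longrightarrow> [a, i] \<notin> X \<and> [a, j] \<notin> X"
      using o(3)[of a] that d by (auto simp: triple_def)
    moreover have "[a, c] \<in> X \<Longrightarrow> [k, a] \<notin> X \<and> [k, k] \<notin> X" for c
      using o(2)[of a c] that by (auto simp: triple_def)
    moreover have "[a, a] \<in> X \<Longrightarrow> [a, b] \<in> X \<Longrightarrow> [b, c] \<notin> X" for c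
      using mv_2_row[OF mv that] by blast
    ultimately show ?thesis
      unfolding r by (elim disjE) (simp_all add: ind_def)
  qed
  note oi = outer[OF t] and oj = outer[OF tp(2)]
  consider "card (slice i X) = 0" "card (slice j X) = 0" | "card (slice i X) = 0" "card (slice j X) \<ge> 1"
    | "card (slice i X) \<ge> 1" "card (slice j X) = 0" | "card (slice i X) \<ge> 1" "card (slice j X) \<ge> 1"
    by linarith
  then show ?thesis
  proof cases
    case 1
    then show ?thesis unfolding card_2_rows[OF t X] r[of k] by (simp add: ind_def)
  next
    case 2
    then have "[k, j] \<notin> X" "[k, k] \<notin> X" using oj by auto
    then have "card (slice k X) \<le> 1" unfolding r by (simp add: ind_def)
    then show ?thesis using 2 oj unfolding card_2_rows[OF t X] by linarith
  next
    case 3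
    then have "[k, i] \<notin> X" "[k, k] \<notin> X" using oi by auto
    then have "card (slice k X) \<le> 1" unfolding r by (simp add: ind_def)
    then show ?thesis using 3 oi unfolding card_2_rows[OF t X] by linarith
  next
    case 4
    then have "[k, i] \<notin> X" "[k, j] \<notin> X" "[k, k] \<notin> X" using oi oj by auto
    then have "card (slice k X) = 0" unfolding r by (simp add: ind_def)
    moreover have "card (slice i X) \<le> 1" "card (slice j X) \<le> 1" using 4 oi oj by linarith+
    ultimately show ?thesis unfolding card_2_rows[OF t X] by linarith
  qed
qed

text \<open>Each row keeps at most one vertex. Not all three are inhabited: vertices of rows
  \<open>i\<close> and \<open>k\<close> on their way to corner \<open>j\<close> pass all of row
  \<open>j\<close> between them.\<close>

lemma card_2_open2:
  assumes t: "triple i j k" and X: "X \<subseteq> SV 2" and j: "open_to X j" and k: "open_to X k"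
  shows "card X \<le> 2"
proof -
  have d: "i \<noteq> j" "i \<noteq> k" "j \<noteq> k" "j \<noteq> i" "k \<noteq> i" "k \<noteq> j" using t by (auto simp: triple_def)
  note oj = open_to_2[OF j X] and ok = open_to_2[OF k X]
  note r = card_row_2[OF t X]
  have i: "card (slice i X) \<le> 1"
    using oj(3)[of i] ok(3)[of i] d unfolding r by (auto simp: ind_def)
  have j: "card (slice j X) \<le> 1"
    using oj(1) ok(3)[of j] d unfolding r by (auto simp: ind_def)
  have k: "card (slice k X) \<le> 1"
    using ok(1) oj(3)[of k] d unfolding r by (auto simp: ind_def)
  have "card (slice i X) = 0 \<or> card (slice j X) = 0 \<or> card (slice k X) = 0"
  proof (rule ccontr)
    assume *: "\<not> ?thesis"
    then obtain a b c where "[i, a] \<in> X" "[j, b] \<in> X" "[k, c] \<in> X"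
      unfolding r by (auto simp: ind_def split: if_splits)
    then have "[j, i] \<notin> X \<and> [j, j] \<notin> X \<and> [j, k] \<notin> X"
      using oj(2)[of i a] oj(2)[of k c] d by blast
    then have "card (slice j X) = 0" unfolding r by (simp add: ind_def)
    then show False using * by blast
  qed
  then show ?thesis
    unfolding card_2_rows[OF t X] using i j k by linarith
qed

text \<open>Only \<open>[j, k]\<close> and \<open>[k, j]\<close> avoid the two sides, and the first
  reaches corner \<open>k\<close> through the second.\<close>

lemma card_2_open3:
  assumes t: "triple i j k" and X: "X \<subseteq> SV 2" and j: "open_to X j" and k: "open_to X k"
    and s: "side i j 2 \<inter> X = {}" "side i k 2 \<inter> X = {}"
  shows "card X \<le> 1"
proof -
  have d: "i \<noteq> j" "i \<noteq> k" "j \<noteq> k" "j \<noteq> i" "k \<noteq> i" "k \<noteq> j" using t by (auto simp: triple_def)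
  have "[i, i] \<notin> X" "[i, j] \<notin> X" "[j, i] \<notin> X" "[j, j] \<notin> X" "[i, k] \<notin> X" "[k, i] \<notin> X" "[k, k] \<notin> X"
    using s by (auto simp: side_def numeral_2_eq_2 disjoint_iff)
  moreover have "[j, k] \<in> X \<Longrightarrow> [k, j] \<notin> X"
    using open_to_2(2)[OF k X, of j k] d by blast
  ultimately show ?thesis
    unfolding card_2_rows[OF t X] card_row_2[OF t X] by (auto simp: ind_def)
qed

lemma near_2:
  assumes t: "triple i j k" and near: "\<forall>s\<in>X. cdist k s < cdist i s"
  shows "[i, a] \<notin> X" "[j, i] \<notin> X" "[j, j] \<notin> X"
  using t by (auto simp: triple_def dest!: bspec[OF near] split: if_splits)

text \<open>Only \<open>[j, k]\<close>, \<open>[k, i]\<close>, \<open>[k, j]\<close> and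
  \<open>[k, k]\<close> are closer to \<open>k\<close> than to \<open>i\<close>. The two named in
  the second claim are closer by exactly one (\<open>cdist_jk_ki\<close>), the gap that later forces
  a hidden vertex into a corner.\<close>

lemma card_2_near:
  assumes t: "triple i j k" and X: "X \<subseteq> SV 2" and k: "open_to X k"
    and near: "\<forall>s\<in>X. cdist k s < cdist i s"
  shows "card X \<le> 2" and "card X \<ge> 2 \<Longrightarrow> [j, k] \<in> X \<or> [k, i] \<in> X"
    and "open_to X i \<Longrightarrow> side i k 2 \<inter> X = {} \<Longrightarrow> card X \<le> 1"
    and "open_to X j \<Longrightarrow> card X \<le> 1"
proof -
  have d: "i \<noteq> j" "i \<noteq> k" "j \<noteq> k" "j \<noteq> i" "k \<noteq> i" "k \<noteq> j" using t by (auto simp: triple_def)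
  note n = near_2[OF t near]
  note ok = open_to_2[OF k X]
  have kk: "[k, k] \<in> X \<Longrightarrow> [k, i] \<notin> X \<and> [k, j] \<notin> X \<and> [j, k] \<notin> X"
    using ok(1,2) d by blast
  have jk: "[j, k] \<in> X \<Longrightarrow> [k, j] \<notin> X" using ok(2)[of j k] d by blast
  show "card X \<le> 2" "card X \<ge> 2 \<Longrightarrow> [j, k] \<in> X \<or> [k, i] \<in> X"
    using kk jk n unfolding card_2_rows[OF t X] card_row_2[OF t X]
    by (auto simp: ind_def split: if_splits)
  show "card X \<le> 1" if "side i k 2 \<inter> X = {}"
  proof -
    have "[k, k] \<notin> X" "[k, i] \<notin> X"
      using that by (auto simp: side_def numeral_2_eq_2 disjoint_iff)
    then show ?thesis using jk n unfolding card_2_rows[OF t X] card_row_2[OF t X] by (auto simp: ind_def)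
  qed
  show "card X \<le> 1" if "open_to X j"
  proof -
    have "[k, i] \<in> X \<Longrightarrow> [j, k] \<notin> X \<and> [k, j] \<notin> X"
      using open_to_2(2,3)[OF that X, of k i] d by blast
    then show ?thesis using kk jk n unfolding card_2_rows[OF t X] card_row_2[OF t X] by (auto simp: ind_def)
  qed
qed

text \<open>\<open>[k, j]\<close> blocks all of row \<open>j\<close>, and the clear side leaves only
  \<open>[i, j]\<close> and \<open>[k, j]\<close> elsewhere.\<close>

lemma card_2_kj:
  assumes t: "triple i j k" and X: "X \<subseteq> SV 2" and k: "open_to X k"
    and s: "side i k 2 \<inter> X = {}" and kj: "[k, j] \<in> X"
  shows "card X \<le> 2"
proof -
  have d: "i \<noteq> j" "i \<noteq> k" "j \<noteq> k" "j \<noteq> i" "k \<noteq> i" "k \<noteq> j" using t by (auto simp: triple_def)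
  have "[i, i] \<notin> X" "[i, k] \<notin> X" "[k, i] \<notin> X" "[k, k] \<notin> X"
    using s by (auto simp: side_def numeral_2_eq_2 disjoint_iff)
  moreover have "[j, b] \<notin> X" for b
    using open_to_2(2)[OF k X, of j b] d kj by blast
  ultimately show ?thesis
    unfolding card_2_rows[OF t X] card_row_2[OF t X] by (auto simp: ind_def)
qed

section \<open>Sets in higher orders\<close>

text \<open>Each corner that must stay visible costs one vertex. With all three corners the bound fails
  without the two clear sides: \<open>S\<^sub>3\<^sup>3\<close> contains four vertices that see all three corners.\<close>

definition bounded_at :: "nat \<Rightarrow> bool" where
  "bounded_at n \<longleftrightarrow> (\<forall>X i j k. X \<subseteq> SV n \<longrightarrow> mv n X \<longrightarrow> triple i j k \<longrightarrow>
     card X \<le> 3 ^ (n - 2) + 3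
   \<and> (open_to X k \<longrightarrow> card X \<le> 3 ^ (n - 2) + 2)
   \<and> (open_to X j \<longrightarrow> open_to X k \<longrightarrow> card X \<le> 3 ^ (n - 2) + 1)
   \<and> (open_to X i \<longrightarrow> open_to X j \<longrightarrow> open_to X k \<longrightarrow> side i j n \<inter> X = {} \<longrightarrow> side i k n \<inter> X = {} \<longrightarrow>
        card X \<le> 3 ^ (n - 2)))"

lemma bounded_at_2: "bounded_at 2"
  unfolding bounded_at_def
proof (intro allI impI conjI)
  fix X i j k
  assume X: "X \<subseteq> SV 2" "mv 2 X" and t: "triple i j k"
  show "card X \<le> 3 ^ (2 - 2) + 3"
    using card_2_free[OF t X] by simp
  show "card X \<le> 3 ^ (2 - 2) + 2" if "open_to X k"
    using card_2_open1[OF t X that] by simp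
  show "card X \<le> 3 ^ (2 - 2) + 1" if "open_to X j" "open_to X k"
    using card_2_open2[OF t X(1) that] by simp
  show "card X \<le> 3 ^ (2 - 2)" if "open_to X j" "open_to X k" "side i j 2 \<inter> X = {}" "side i k 2 \<inter> X = {}"
    using card_2_open3[OF t X(1) that] by simp
qed

lemma bounded_atD:
  assumes "bounded_at n" "X \<subseteq> SV n" "mv n X" "triple i j k"
  shows "card X \<le> 3 ^ (n - 2) + 3"
    and "open_to X k \<Longrightarrow> card X \<le> 3 ^ (n - 2) + 2"
    and "open_to X j \<Longrightarrow> open_to X k \<Longrightarrow> card X \<le> 3 ^ (n - 2) + 1"
    and "open_to X i \<Longrightarrow> open_to X j \<Longrightarrow> open_to X k \<Longrightarrow> side i j n \<inter> X = {} \<Longrightarrow> side i k n \<inter> X = {} \<Longrightarrow>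
        card X \<le> 3 ^ (n - 2)"
  using assms unfolding bounded_at_def by blast+

text \<open>One linear inequality for all eight choices of corners, so that later counts can add up
  flags instead of splitting cases.\<close>

lemma bounded_flags:
  assumes b: "bounded_at n" "X \<subseteq> SV n" "mv n X" and t: "triple i j k"
    and p: "pi \<Longrightarrow> open_to X i" "pj \<Longrightarrow> open_to X j" "pk \<Longrightarrow> open_to X k"
    and s: "pi \<Longrightarrow> pj \<Longrightarrow> pk \<Longrightarrow> side i j n \<inter> X = {} \<and> side i k n \<inter> X = {}"
  shows "card X + ind pi + ind pj + ind pk \<le> 3 ^ (n - 2) + 3"
proof -
  note tp = triple_perm[OF t]
  note B = bounded_atD[OF b]
  have "card X \<le> 3 ^ (n - 2) + 3" using B(1)[OF t] .
  moreover have "pi \<longrightarrow> card X \<le> 3 ^ (n - 2) + 2" using B(2)[OF tp(3)] p by blast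
  moreover have "pj \<longrightarrow> card X \<le> 3 ^ (n - 2) + 2" using B(2)[OF tp(1)] p by blast
  moreover have "pk \<longrightarrow> card X \<le> 3 ^ (n - 2) + 2" using B(2)[OF t] p by blast
  moreover have "pi \<longrightarrow> pj \<longrightarrow> card X \<le> 3 ^ (n - 2) + 1" using B(3)[OF tp(4)] p by blast
  moreover have "pi \<longrightarrow> pk \<longrightarrow> card X \<le> 3 ^ (n - 2) + 1" using B(3)[OF tp(2)] p by blast
  moreover have "pj \<longrightarrow> pk \<longrightarrow> card X \<le> 3 ^ (n - 2) + 1" using B(3)[OF t] p by blast
  moreover have "pi \<longrightarrow> pj \<longrightarrow> pk \<longrightarrow> card X \<le> 3 ^ (n - 2)" using B(4)[OF t] p s by blast
  ultimately show ?thesis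
    by (cases pi; cases pj; cases pk) (simp_all add: ind_def)
qed

lemma cdist_Cons_less:
  assumes t: "triple i j k" and "length s = p"
  shows "\<not> cdist k (i # s) < cdist i (i # s)"
    and "cdist k (j # s) < cdist i (j # s) \<longleftrightarrow> cdist k s < cdist i s"
  using assms cdist_less[of i s] by (auto simp: triple_def)

text \<open>The situation that \<open>hidden_corner\<close> leaves in copy \<open>j\<close>.
  Nearness passes to subcopy \<open>j\<close>, since its first letter adds the same to both
  distances. A vertex of subcopy \<open>k\<close> not seeing \<open>j\<close> would force subcopy
  \<open>j\<close> to be closer to \<open>i\<close> than to \<open>k\<close>, against
  nearness.\<close>

lemma near_structure:
  assumes B: "B \<subseteq> SV (Suc p)" "mv (Suc p) B" and t: "triple i j k" and k: "open_to B k"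
    and near: "\<forall>s\<in>B. cdist k s < cdist i s"
  shows "slice i B = {}"
    and "\<forall>s\<in>slice j B. cdist k s < cdist i s"
    and "slice j B \<noteq> {} \<Longrightarrow> open_to (slice k B) j"
    and "slice j B \<noteq> {} \<Longrightarrow> side j k p \<inter> slice k B = {}"
    and "card B = card (slice j B) + card (slice k B)"
proof -
  have l: "length s = p" if "a # s \<in> B" for a s
    using that B(1) by (auto simp: sierp_V_def)
  show 1: "slice i B = {}"
    using near l cdist_Cons_less(1)[OF t] by (auto simp: slice_def)
  show near': "\<forall>s\<in>slice j B. cdist k s < cdist i s"
  proof
    fix s assume "s \<in> slice j B"
    then have "j # s \<in> B" by simp
    then show "cdist k s < cdist i s"
      using near cdist_Cons_less(2)[OF t l] by blast
  qed
  show "side j k p \<inter> slice k B = {}" if "slice j B \<noteq> {}"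
    using open_to_side[OF B(1) k that] t by (auto simp: triple_def)
  show "open_to (slice k B) j" if "slice j B \<noteq> {}"
  proof (rule ccontr)
    assume "\<not> open_to (slice k B) j"
    then obtain s where "s \<in> slice k B" "\<not> sees (slice k B) j s" by (auto simp: open_to_def)
    from hidden_corner(3)[OF B(2,1) triple_perm(5)[OF t] this] near' that show False by fastforce
  qed
  show "card B = card (slice j B) + card (slice k B)"
    using card_eq_sum_slice[OF t B(1)] 1 by simp
qed

lemma mv_slice_triple:
  assumes "mv (Suc m) X" "triple i j k"
  shows "mv m (slice i X)" "mv m (slice j X)" "mv m (slice k X)"
  using assms by (auto simp: triple_def)

text \<open>With c = 3^(p-2), the inhabited subcopies \<open>j\<close> and \<open>k\<close> hold at
  most c+2 and c+1; if corner \<open>i\<close> must be visible too, each holds at most c+1.\<close>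

lemma near_card_ge:
  assumes p: "p \<ge> 2" "bounded_at p"
    and B: "B \<subseteq> SV (Suc p)" "mv (Suc p) B" and t: "triple i j k" and k: "open_to B k"
    and near: "\<forall>s\<in>B. cdist k s < cdist i s"
  shows "card B \<le> 2 * 3 ^ (p - 2) + 3" and "open_to B i \<Longrightarrow> card B \<le> 2 * 3 ^ (p - 2) + 2"
proof -
  note st = near_structure[OF B t k near]
  note tp = triple_perm[OF t]
  note bj = bounded_atD[OF p(2) slice_SV[OF B(1), of j] mv_slice_triple(2)[OF B(2) t]]
  note bk = bounded_atD[OF p(2) slice_SV[OF B(1), of k] mv_slice_triple(3)[OF B(2) t]]
  note o = open_to_slice[OF B(1)]
  show "card B \<le> 2 * 3 ^ (p - 2) + 3"
    using bj(2)[OF t o[OF k]] bk(2)[OF t o[OF k]] bk(3)[OF t st(3) o[OF k]] st(5)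
    by (cases "slice j B = {}") auto
  show "card B \<le> 2 * 3 ^ (p - 2) + 2" if "open_to B i"
    using bj(3)[OF tp(2) o[OF that] o[OF k]] bk(3)[OF tp(2) o[OF that] o[OF k]] st(5)
    by auto
qed

lemma cdist_jk_ki:
  assumes "triple i j k"
  shows "cdist i [j, k] = cdist k [j, k] + 1" "cdist i [k, i] = cdist k [k, i] + 1"
  using assms by (auto simp: triple_def)

text \<open>For order three \<open>near_card_ge\<close> would give 5 and 4, each one too many. The
  last two claims add vertices with a small gap between the distances to \<open>i\<close> and
  \<open>k\<close>, to be traded against the size of the part that contains the hidden
  vertex.\<close>

lemma near_card_3:
  assumes B: "B \<subseteq> SV 3" "mv 3 B" and t: "triple i j k" and k: "open_to B k"
    and near: "\<forall>s\<in>B. cdist k s < cdist i s"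
  shows "card B \<le> 4"
    and "open_to B i \<Longrightarrow> side i k 3 \<inter> B = {} \<Longrightarrow> card B \<le> 3"
    and "open_to B i \<Longrightarrow> side i k 3 \<inter> B = {} \<Longrightarrow> card B \<ge> 3 \<Longrightarrow> \<exists>y\<in>B. cdist i y = cdist k y + 1"
    and "open_to B i \<Longrightarrow> card B \<le> 2 \<or> (card B \<le> 3 \<and> (\<exists>y\<in>B. cdist i y \<le> cdist k y + 3))
       \<or> (\<exists>y\<in>B. cdist i y = cdist k y + 1)"
proof -
  have B': "B \<subseteq> SV (Suc 2)" "mv (Suc 2) B" using B by (simp_all add: numeral_3_eq_3 numeral_2_eq_2)
  note st = near_structure[OF B' t k near]
  note tp = triple_perm[OF t]
  have d: "i \<noteq> j" "i \<noteq> k" "j \<noteq> k" using t by (auto simp: triple_def)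
  have sj: "slice j B \<subseteq> SV 2" and sk: "slice k B \<subseteq> SV 2" using slice_SV[OF B'(1)] by auto
  have mj: "mv 2 (slice j B)" and mk: "mv 2 (slice k B)" using mv_slice_triple[OF B'(2) t] by auto
  note o = open_to_slice[OF B'(1)]
  note nj = card_2_near[OF t sj o[OF k] st(2)]
  have kj2: "card (slice k B) \<le> 2" if "slice j B \<noteq> {}"
    using card_2_open2[OF t sk st(3)[OF that] o[OF k]] .
  have k3: "card (slice k B) \<le> 3" using card_2_open1[OF t sk mk o[OF k]] .
  \<comment> \<open>The letter \<open>j\<close> in front adds 4 to both distances, so a gap of one
    in subcopy \<open>j\<close> survives.\<close>
  have wit: "\<exists>y\<in>B. cdist i y = cdist k y + 1" if "card (slice j B) \<ge> 2"
  proof -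
    have *: "[j, k] \<in> slice j B \<or> [k, i] \<in> slice j B" using nj(2)[OF that] .
    have **: "cdist i (j # v) = cdist k (j # v) + 1" if "cdist i v = cdist k v + 1" for v
      using that d by simp
    from * show ?thesis using cdist_jk_ki[OF t] ** by (metis mem_slice)
  qed
  show "card B \<le> 4"
    using nj(1) kj2 k3 st(5) by (cases "slice j B = {}") auto
  show c3: "card B \<le> 3" and "card B \<ge> 3 \<Longrightarrow> \<exists>y\<in>B. cdist i y = cdist k y + 1"
    if i: "open_to B i" and s: "side i k 3 \<inter> B = {}"
  proof -
    have ki2: "card (slice k B) \<le> 2"
      using card_2_open2[OF tp(2) sk o[OF i] o[OF k]] .
    have s2: "side i k 2 \<inter> slice k B = {}"
      using slice_side[of i k 2 B k] s by (simp add: numeral_3_eq_3 numeral_2_eq_2)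
    have k1: "card (slice k B) \<le> 1" if "slice j B \<noteq> {}"
      using card_2_open3[OF tp(4) sk o[OF i] st(3)[OF that]] st(4)[OF that] s2
      by (simp add: side_commute)
    show "card B \<le> 3"
      using nj(1) ki2 k1 st(5) by (cases "slice j B = {}") auto
    show "\<exists>y\<in>B. cdist i y = cdist k y + 1" if "card B \<ge> 3"
    proof (rule wit)
      show "card (slice j B) \<ge> 2"
        using that ki2 k1 st(5) by (cases "slice j B = {}") auto
    qed
  qed
  show "card B \<le> 2 \<or> (card B \<le> 3 \<and> (\<exists>y\<in>B. cdist i y \<le> cdist k y + 3))
       \<or> (\<exists>y\<in>B. cdist i y = cdist k y + 1)" if i: "open_to B i"
  proof (cases "slice j B = {}")
    case True
    then show ?thesis using card_2_open2[OF tp(2) sk o[OF i] o[OF k]] st(5) by simp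
  next
    case False
    then obtain y where y: "y \<in> slice j B" by blast
    then have "length y = 2" using sj SV_length by blast
    \<comment> \<open>A word of length two is at distance at most 2^2 - 1 = 3 from any
      corner.\<close>
    then have "cdist i (j # y) \<le> cdist k (j # y) + 3"
      using cdist_less[of i y] d by simp
    then have "\<exists>y\<in>B. cdist i y \<le> cdist k y + 3" using y by (metis mem_slice)
    moreover have "card (slice j B) \<ge> 2 \<or> card B \<le> 3"
      using kj2[OF False] st(5) by linarith
    ultimately show ?thesis using wit by blast
  qed
qed

lemma cdist_0: "cdist k s = 0 \<Longrightarrow> s = replicate (length s) k"
  by (induction s) (auto split: if_splits)

lemma corner_in_cpath: "replicate (length s) k \<in> cpath k s"
  by (induction s) auto

lemma open_to_corner:
  assumes "A \<subseteq> SV m" "open_to A k" "replicate m k \<in> A"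
  shows "card A \<le> 1"
proof -
  have "s = replicate m k" if "s \<in> A" for s
  proof -
    have "length s = m" using that assms(1) SV_length by blast
    then have "replicate m k \<in> cpath k s \<inter> A" using corner_in_cpath[of s k] assms(3) by simp
    then show ?thesis using that assms(2) by (auto simp: open_to_def sees_def)
  qed
  then have "A \<subseteq> {replicate m k}" by blast
  then show ?thesis using card_mono[of "{replicate m k}" A] by simp
qed

text \<open>Openness to \<open>k\<close> alone gives 5. The 5 in \<open>far\<close> is 2^3 - 3: the
  detour inequality for a vertex on the other side whose gap is at most 3.\<close>

lemma card_3_hidden:
  assumes A: "A \<subseteq> SV 3" "mv 3 A" and t: "triple i j k" and k: "open_to A k"
    and s0: "s0 \<in> A" "\<not> sees A j s0"
    and far: "\<And>s. s \<in> A \<Longrightarrow> \<not> sees A j s \<Longrightarrow> cdist k s + 5 \<le> cdist j s"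
  shows "card A \<le> 4"
proof -
  have A': "A \<subseteq> SV (Suc 2)" "mv (Suc 2) A" using A by (simp_all add: numeral_3_eq_3 numeral_2_eq_2)
  have d: "i \<noteq> j" "i \<noteq> k" "j \<noteq> k" "j \<noteq> i" "k \<noteq> i" "k \<noteq> j" "i < 3" "j < 3" "k < 3"
    using t by (auto simp: triple_def)
  note tp = triple_perm[OF t]
  note o = open_to_slice[OF A'(1)]
  note s2 = slice_SV[OF A'(1)]
  note m2 = mv_slice_triple[OF A'(2) t]
  \<comment> \<open>Outside subcopy \<open>k\<close> the distance to \<open>k\<close> is at least 4,
    so \<open>far\<close> would ask for a distance of at least 9 to \<open>j\<close>, but distances
    are at most 7.\<close>
  have hk: "a = k" if "a # x \<in> A" "\<not> sees A j (a # x)" for a x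
  proof (rule ccontr)
    assume "a \<noteq> k"
    have "length x = 2" using that A'(1) by (auto simp: sierp_V_def)
    then show False
      using far[OF that] \<open>a \<noteq> k\<close> cdist_less[of j x] by (simp split: if_splits)
  qed
  obtain x where x: "s0 = k # x" "x \<in> slice k A"
  proof -
    obtain a x where "s0 = a # x" using s0 A'(1) by (metis SV_SucE subsetD)
    then show ?thesis using hk[of a x] s0 that by auto
  qed
  then have "x \<in> SV 2" using s2 by blast
  then obtain a b where ab: "x = [a, b]" "a < 3" "b < 3"
    by (auto simp: sierp_V_def numeral_2_eq_2 length_Suc_conv)
  have "cdist k x + 1 \<le> cdist j x"
    using far[OF s0] x ab d by simp
  then have xc: "x \<in> side i k 2 \<or> x = [k, j]" and xk: "x = [k, j] \<Longrightarrow> x \<in> side j k 2"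
    using ab d triple_less[OF t, of a] triple_less[OF t, of b]
    by (auto simp: side_def split: if_splits)
  have nj: "open_to (slice a A) j" if "a \<noteq> k" for a
    unfolding open_to_def
  proof
    fix s assume s: "s \<in> slice a A"
    then have "sees A j (a # s)" using hk that by auto
    moreover have "length s = 2" using s s2 SV_length by blast
    ultimately show "sees (slice a A) j s" using sees_Cons by blast
  qed
  have c: "card A = card (slice i A) + card (slice j A) + card (slice k A)"
    using card_eq_sum_slice[OF t A'(1)] .
  have ci: "card (slice i A) \<le> 2" using card_2_open2[OF t s2 nj o[OF k]] d by blast
  have cj: "card (slice j A) \<le> 2" using card_2_open2[OF t s2 nj o[OF k]] d by blast
  have ck: "card (slice k A) \<le> 3" using card_2_open1[OF t s2 m2(3) o[OF k]] .
  show ?thesis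
  \<comment> \<open>If subcopy \<open>i\<close> is inhabited, its vertices need the side from
    \<open>i\<close> to \<open>k\<close>, which leaves \<open>[k, j]\<close> for \<open>x\<close>;
    this in turn blocks subcopy \<open>j\<close>. If it is empty, either \<open>slice k A\<close> is
    open to \<open>j\<close>, giving 2 + 2, or \<open>slice j A\<close> is near and open to
    \<open>j\<close>, giving 3 + 1.\<close>
  proof (cases "slice i A = {}")
    case False
    have ik: "side i k 2 \<inter> slice k A = {}" using open_to_side[OF A'(1) k False] d by blast
    then have xkj: "x = [k, j]" using xc x by blast
    have "slice j A = {}"
    proof (rule ccontr)
      assume "slice j A \<noteq> {}"
      then have "side j k 2 \<inter> slice k A = {}" using open_to_side[OF A'(1) k] d by blast
      then show False using xk[OF xkj] x by blast
    qed
    moreover have "card (slice k A) \<le> 2"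
      using card_2_kj[OF t s2 o[OF k] ik] x xkj by blast
    ultimately show ?thesis using c ci by simp
  next
    case True
    show ?thesis
    proof (cases "open_to (slice k A) j")
      case True
      then have "card (slice k A) \<le> 2" using card_2_open2[OF t s2 _ o[OF k]] by blast
      then show ?thesis using c \<open>slice i A = {}\<close> cj by simp
    next
      case False
      then obtain s where s: "s \<in> slice k A" "\<not> sees (slice k A) j s" by (auto simp: open_to_def)
      note h = hidden_corner[OF A'(2,1) tp(5) s]
      have "card (slice j A) \<le> 1"
        by (rule card_2_near(4)[OF tp(5) s2 h(1)]) (use h(3) nj d in auto)
      then show ?thesis using c \<open>slice i A = {}\<close> ck by simp
    qed
  qed
qed

section \<open>Induction on the order\<close>

text \<open>The estimate 2 * 3^(m-3) + 3 is at most 3^(m-2) + 1 only from m = 4 on, so the two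
  smaller orders use their own lemmas.\<close>

lemma near_card:
  assumes m: "m \<ge> 2" "m \<ge> 3 \<Longrightarrow> bounded_at (m - 1)"
    and B: "B \<subseteq> SV m" "mv m B" and t: "triple i j k" and k: "open_to B k"
    and near: "\<forall>s\<in>B. cdist k s < cdist i s"
  shows "card B \<le> 3 ^ (m - 2) + 1"
proof -
  consider "m = 2" | "m = 3" | p where "m = Suc (Suc (Suc (Suc p)))"
    using m(1) by (metis One_nat_def Suc_1 add_2_eq_Suc le_Suc_ex not0_implies_Suc numeral_3_eq_3)
  then show ?thesis
  proof cases
    case 1
    then show ?thesis using card_2_near(1)[OF t _ k near] B by simp
  next
    case 2
    then show ?thesis using near_card_3(1)[OF _ _ t k near] B by simp
  next
    case 3
    have "card B \<le> 2 * 3 ^ (Suc (Suc (Suc p)) - 2) + 3"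
      by (rule near_card_ge(1)[OF _ _ _ _ t k near]) (use m(2) B 3 in auto)
    moreover have "(3::nat) ^ p \<ge> 1" by simp
    moreover have "3 ^ (Suc (Suc (Suc p)) - 2) = 3 * (3::nat) ^ p" "3 ^ (m - 2) = 9 * (3::nat) ^ p"
      using 3 by simp_all
    ultimately show ?thesis by linarith
  qed
qed

text \<open>The average allowed per part is c+1. Part \<open>k\<close> cannot exceed it, as it must
  be open to \<open>i\<close> and \<open>j\<close>. Part \<open>i\<close> may exceed it by hiding
  corners, and part \<open>j\<close>, near to \<open>k\<close>, has to compensate. The second claim
  prepares the description of the extremal sets.\<close>

lemma offender_step:
  assumes m: "m \<ge> 2" "bounded_at m" "m \<ge> 3 \<Longrightarrow> bounded_at (m - 1)"
    and X: "X \<subseteq> SV (Suc m)" "mv (Suc m) X" and t: "triple i j k"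
    and s0: "s0 \<in> slice i X" "\<not> sees (slice i X) j s0"
    and ne: "slice j X \<noteq> {}" "slice k X \<noteq> {}"
    and K: "\<And>a. a < 3 \<Longrightarrow> K a \<Longrightarrow> open_to X a"
  shows "card X + ind (K i) + ind (K j) + ind (K k) \<le> 3 * 3 ^ (m - 2) + 3"
    and "m \<ge> 3 \<Longrightarrow> card X < 3 * 3 ^ (m - 2) + 3 \<or>
        card (slice i X) = 3 ^ (m - 2) + 1 \<and> card (slice j X) = 3 ^ (m - 2) + 1 \<and> card (slice k X) = 3 ^ (m - 2) + 1"
proof -
  define A B G where "A = slice i X" and "B = slice j X" and "G = slice k X"
  define c :: nat where "c = 3 ^ (m - 2)"
  note d = t[unfolded triple_def]
  note tp = triple_perm[OF t]
  have S: "A \<subseteq> SV m" "B \<subseteq> SV m" "G \<subseteq> SV m" and M: "mv m A" "mv m B" "mv m G"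
    using slice_SV[OF X(1)] mv_slice_triple[OF X(2) t] by (auto simp: A_def B_def G_def)
  have card: "card X = card A + card B + card G"
    using card_eq_sum_slice[OF t X(1)] by (simp add: A_def B_def G_def)
  note o = open_to_slice[OF X(1)]
  note h = hidden_corner[OF X(2,1) t s0]
  have Bk: "open_to B k" and nB: "\<forall>s\<in>B. cdist k s < cdist i s"
    using h(1,3) by (auto simp: B_def)
  have s0k: "cdist k s0 < cdist j s0" using h(4) ne by blast
  \<comment> \<open>A vertex of part \<open>k\<close> not seeing \<open>i\<close> would force all of
    part \<open>i\<close> to be closer to \<open>j\<close> than to \<open>k\<close>, but
    \<open>s0\<close> is closer to \<open>k\<close>.\<close>
  have Gi: "open_to G i"
  proof (rule ccontr)
    assume "\<not> open_to G i"
    then obtain s where "s \<in> slice k X" "\<not> sees (slice k X) i s" by (auto simp: G_def open_to_def)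
    from hidden_corner(3)[OF X(2,1) tp(4) this s0(1)] s0k show False by simp
  qed
  have Gj: "open_to G j"
  proof (rule ccontr)
    assume "\<not> open_to G j"
    then obtain s where s: "s \<in> slice k X" "\<not> sees (slice k X) j s" by (auto simp: G_def open_to_def)
    obtain y where "y \<in> slice j X" using ne by blast
    from hidden_corner(3)[OF X(2,1) tp(5) s this] h(3)[OF this] show False by simp
  qed
  have Kj: "\<not> K j" using K[of j] o[of j i] s0 d by (auto simp: open_to_def)
  have Gb: "card G + ind (K k) \<le> c + 1"
  proof -
    have "card G + ind (K k) + ind True + ind True \<le> 3 ^ (m - 2) + 3"
    proof (rule bounded_flags[OF m(2) S(3) M(3) tp(4)])
      show "open_to G k" if "K k" using K[OF _ that] o d by (simp add: G_def)
      show "side k i m \<inter> G = {} \<and> side k j m \<inter> G = {}" if "K k"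
      proof -
        have "slice i X \<noteq> {}" using s0 by blast
        then have "side i k m \<inter> slice k X = {}" "side j k m \<inter> slice k X = {}"
          using open_to_side[OF X(1) K[OF _ that]] d ne by auto
        then show ?thesis by (simp add: G_def side_commute)
      qed
    qed (use Gi Gj in auto)
    then show ?thesis by (simp add: ind_def c_def)
  qed
  have cases_m: thesis if "m = 2 \<Longrightarrow> thesis" "m = 3 \<Longrightarrow> thesis"
    "\<And>p q. m = Suc p \<Longrightarrow> p \<ge> 2 \<Longrightarrow> bounded_at p \<Longrightarrow> q = 3 ^ (p - 2) \<Longrightarrow> q \<ge> 3 \<Longrightarrow> c = 3 * q \<Longrightarrow> thesis" for thesis
  proof -
    consider "m = 2" | "m = 3" | p where "m = Suc (Suc (Suc (Suc p)))"
      using m(1) by (metis One_nat_def Suc_1 add_2_eq_Suc le_Suc_ex not0_implies_Suc numeral_3_eq_3)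
    then show thesis
    proof cases
      case 3
      have "(3::nat) ^ p \<ge> 1" by simp
      then show thesis
        using that(3)[of "Suc (Suc (Suc p))" "3 ^ Suc p"] 3 m(3) by (simp add: c_def)
    qed (use that in auto)
  qed
  have Ab: "card A + ind (K i) \<le> c + 3"
  proof -
    have "card A + ind (K i) + ind False + ind False \<le> 3 ^ (m - 2) + 3"
      by (rule bounded_flags[OF m(2) S(1) M(1) t])
        (use K[of i] o d in \<open>auto simp: A_def\<close>)
    then show ?thesis by (simp add: ind_def c_def)
  qed
  \<comment> \<open>With gap one the detour inequality becomes
    \<open>cdist k s + 2 ^ m \<le> cdist j s + 1\<close>, and the right side is at most 2^m.\<close>
  have corner: "s = replicate m k"
    if "s \<in> A" "\<not> sees A j s" "y \<in> B" "cdist i y = cdist k y + 1" for s y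
  proof -
    have "cdist k s + cdist k y + 2 ^ m \<le> cdist j s + cdist i y"
      by (rule hidden_corner(2)[OF X(2,1) t]) (use that in \<open>simp_all only: A_def B_def not_False_eq_True\<close>)
    moreover have "length s = m" using that S SV_length by blast
    moreover have "cdist j s < 2 ^ m" using cdist_less[of j s] calculation by simp
    ultimately have "cdist k s = 0" using that(4) by linarith
    then show ?thesis using cdist_0[of k s] \<open>length s = m\<close> by simp
  qed
  have s0A: "s0 \<in> A" "\<not> sees A j s0" using s0 by (auto simp: A_def)
  have main: "card A + card B + card G + ind (K i) + ind (K k) \<le> 3 * c + 3 \<and>
    (m \<ge> 3 \<longrightarrow> card A + card B + card G < 3 * c + 3 \<or> card A = c + 1 \<and> card B = c + 1 \<and> card G = c + 1)"
  proof (cases "open_to A k")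
    case False
    then obtain s1 where s1: "s1 \<in> slice i X" "\<not> sees (slice i X) k s1"
      by (auto simp: A_def open_to_def)
    note h1 = hidden_corner[OF X(2,1) tp(1) s1]
    have nG: "\<forall>s\<in>G. cdist j s < cdist i s" using h1(3) by (auto simp: G_def)
    have s1j: "cdist j s1 < cdist k s1" using h1(4) ne by blast
    have Bi: "open_to B i"
    proof (rule ccontr)
      assume "\<not> open_to B i"
      then obtain s where "s \<in> slice j X" "\<not> sees (slice j X) i s" by (auto simp: B_def open_to_def)
      from hidden_corner(3)[OF X(2,1) tp(2) this s1(1)] s1j show False by simp
    qed
    have sB: "side i k m \<inter> B = {}" using h1(5) ne by (simp add: B_def)
    have sG: "side i j m \<inter> G = {}" using h(5) ne by (simp add: G_def)
    have Kk: "ind (K k) = 0" using K[of k] o[of k i] s1 d by (auto simp: open_to_def ind_def)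
    show ?thesis
    proof (rule cases_m)
      assume 2: "m = 2"
      have "card B \<le> 1" using card_2_near(3)[OF t _ Bk nB Bi] S sB 2 by simp
      moreover have "card G \<le> 1" using card_2_near(3)[OF tp(1) _ Gj nG Gi] S sG 2 by simp
      ultimately show ?thesis using Ab Kk 2 by (simp add: c_def)
    next
      assume 3: "m = 3"
      note SM = S[unfolded 3] M[unfolded 3]
      note nB3 = near_card_3[OF SM(2,5) t Bk nB] and nG3 = near_card_3[OF SM(3,6) tp(1) Gj nG]
      have b: "card B \<le> 3" "card G \<le> 3"
        using nB3(2)[OF Bi] nG3(2)[OF Gi] sB sG 3 by simp_all
      \<comment> \<open>Sizes 3 and 3 with 6 in \<open>A\<close> would reach 12 with unequal parts.
        But vertices of gap one put \<open>s0\<close> and \<open>s1\<close> at the corners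
        \<open>k\<close> and \<open>j\<close>. These hide both corners from any further vertex of
        \<open>A\<close>, which would then have to be closer to \<open>k\<close> than to
        \<open>j\<close> and vice versa.\<close>
      have "card A \<le> 2" if "card B \<ge> 3" "card G \<ge> 3"
      proof -
        have "\<exists>y\<in>B. cdist i y = cdist k y + 1" using nB3(3)[OF Bi] sB 3 that by simp
        then have k: "replicate m k \<in> A" using corner s0A by metis
        have "\<exists>y\<in>G. cdist i y = cdist j y + 1" using nG3(3)[OF Gi] sG 3 that by simp
        then obtain y where y: "y \<in> G" "cdist i y = cdist j y + 1" by blast
        have ls: "length s1 = m" using s1 S SV_length by (auto simp: A_def)
        have "cdist j s1 + cdist j y + 2 ^ m \<le> cdist k s1 + cdist i y"
          by (rule h1(2)) (use y(1) in \<open>simp only: G_def\<close>)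
        moreover have "cdist k s1 < 2 ^ m" using cdist_less[of k s1] ls by simp
        ultimately have "cdist j s1 = 0" using y(2) by linarith
        then have j: "replicate m j \<in> A" using cdist_0[of j s1] ls s1 by (simp add: A_def)
        have "x = replicate m k \<or> x = replicate m j" if x: "x \<in> A" for x
        proof (rule ccontr)
          assume n: "\<not> ?thesis"
          have "length x = m" using x S SV_length by blast
          then have "\<not> sees A k x" "\<not> sees A j x"
            using n j k corner_in_cpath[of x k] corner_in_cpath[of x j] by (auto simp: sees_def)
          then have "cdist j x < cdist k x" "cdist k x < cdist j x"
            using hidden_corner(4)[OF X(2,1) tp(1)] hidden_corner(4)[OF X(2,1) t] x ne by (fastforce simp: A_def)+
          then show False by simp
        qed
        then have "A \<subseteq> {replicate m k, replicate m j}" by blast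
        then have "card A \<le> card {replicate m k, replicate m j}" by (rule card_mono[rotated]) simp
        also have "\<dots> \<le> 2" by (simp add: card_insert_if)
        finally show ?thesis .
      qed
      moreover have "ind (K i) \<le> 1" by (simp add: ind_def)
      ultimately show ?thesis using b Ab Kk 3 by (simp add: c_def) linarith
    next
      fix p q assume p: "m = Suc p" "p \<ge> 2" "bounded_at p" "q = 3 ^ (p - 2)" "q \<ge> 3" "c = 3 * q"
      note SM = S[unfolded p(1)] M[unfolded p(1)]
      have "card B \<le> 2 * q + 2" "card G \<le> 2 * q + 2"
        using near_card_ge(2)[OF p(2,3) SM(2,5) t Bk nB Bi]
          near_card_ge(2)[OF p(2,3) SM(3,6) tp(1) Gj nG Gi] p(4) by simp_all
      then show ?thesis using Ab Kk p(5,6) by (intro conjI impI disjI1) linarith+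
    qed
  next
    case True
    have Ab1: "card A + ind (K i) \<le> c + 2"
    proof -
      have "card A + ind (K i) + ind False + ind True \<le> 3 ^ (m - 2) + 3"
        by (rule bounded_flags[OF m(2) S(1) M(1) t])
          (use K[of i] o d True in \<open>auto simp: A_def\<close>)
      then show ?thesis by (simp add: ind_def c_def)
    qed
    \<comment> \<open>The hidden vertex is then the corner \<open>k\<close> itself, and a set open
      to \<open>k\<close> that contains this corner has no other vertex.\<close>
    have A1: "card A \<le> 1" if "\<exists>y\<in>B. cdist i y = cdist k y + 1"
      using open_to_corner[OF S(1) True] corner s0A that by metis
    show ?thesis
    proof (cases "open_to B i")
      case Bi: True
      show ?thesis
      proof (rule cases_m)
        assume 2: "m = 2"
        have "card B \<le> 2" "card B \<ge> 2 \<Longrightarrow> \<exists>y\<in>B. cdist i y = cdist k y + 1"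
          using card_2_near(1,2)[OF t _ Bk nB] S(2)[unfolded 2] cdist_jk_ki[OF t] by blast+
        then have "card B \<le> 1 \<or> card B \<le> 2 \<and> card A \<le> 1" using A1 by linarith
        moreover have "ind (K i) \<le> 1" by (simp add: ind_def)
        ultimately show ?thesis using Ab1 Gb 2 by (simp add: c_def) linarith
      next
        assume 3: "m = 3"
        note SM = S[unfolded 3] M[unfolded 3]
        have "card B \<le> 2 \<or> card B \<le> 3 \<and> card A \<le> 4 \<or> card A \<le> 1"
          using near_card_3(4)[OF SM(2,5) t Bk nB Bi]
        proof (elim disjE conjE)
          assume "\<exists>y\<in>B. cdist i y \<le> cdist k y + 3" "card B \<le> 3"
          then obtain y where y: "y \<in> B" "cdist i y \<le> cdist k y + 3" by blast
          \<comment> \<open>The gap of \<open>y\<close> is at most 3, so a hidden vertex is closer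
            to \<open>k\<close> than to \<open>j\<close> by at least 2^3 - 3 = 5.\<close>
          have "card A \<le> 4"
          proof (rule card_3_hidden[OF SM(1,4) t True s0A])
            fix s assume "s \<in> A" "\<not> sees A j s"
            then have "cdist k s + cdist k y + 2 ^ m \<le> cdist j s + cdist i y"
              by (intro hidden_corner(2)[OF X(2,1) t]) (use y in \<open>simp_all only: A_def B_def not_False_eq_True\<close>)
            then show "cdist k s + 5 \<le> cdist j s" using y(2) 3 by simp
          qed
          then show ?thesis using \<open>card B \<le> 3\<close> by blast
        qed (use A1 in blast)+
        moreover have "card B \<le> 4" using near_card_3(1)[OF SM(2,5) t Bk nB] .
        moreover have "ind (K i) \<le> 1" by (simp add: ind_def)
        ultimately show ?thesis using Ab1 Gb 3 by (simp add: c_def) linarith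
      next
        fix p q assume p: "m = Suc p" "p \<ge> 2" "bounded_at p" "q = 3 ^ (p - 2)" "q \<ge> 3" "c = 3 * q"
        note SM = S[unfolded p(1)] M[unfolded p(1)]
        have "card B \<le> 2 * q + 2"
          using near_card_ge(2)[OF p(2,3) SM(2,5) t Bk nB Bi] p(4) by simp
        then show ?thesis using Ab1 Gb p(5,6) by (intro conjI impI disjI1) linarith+
      qed
    next
      case False
      then obtain s2 where s2: "s2 \<in> slice j X" "\<not> sees (slice j X) i s2"
        by (auto simp: B_def open_to_def)
      \<comment> \<open>A second offender, in copy \<open>j\<close>, makes \<open>A\<close> near as
        well. For \<open>m = 3\<close> the bounds are now 4, 4 and 4, the only place from order
        \<open>m = 3\<close> on where these estimates still permit equality; there all parts have
        size c+1.\<close>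
      have nA: "\<forall>s\<in>A. cdist k s < cdist j s"
        using hidden_corner(3)[OF X(2,1) tp(2) s2] by (auto simp: A_def)
      have Ki: "ind (K i) = 0" using K[of i] o[of i j] s2 d by (auto simp: open_to_def ind_def)
      show ?thesis
      proof (rule cases_m)
        assume 2: "m = 2"
        have "card A \<le> 2" "card B \<le> 2"
          using card_2_near(1)[OF t _ Bk nB] card_2_near(1)[OF tp(2) _ True nA] S 2 by auto
        then show ?thesis using Ki Gb 2 by (simp add: c_def)
      next
        assume 3: "m = 3"
        note SM = S[unfolded 3] M[unfolded 3]
        have "card A \<le> 4" "card B \<le> 4"
          using near_card_3(1)[OF SM(2,5) t Bk nB] near_card_3(1)[OF SM(1,4) tp(2) True nA] by auto
        then show ?thesis using Ki Gb 3 by (simp add: c_def) linarith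
      next
        fix p q assume p: "m = Suc p" "p \<ge> 2" "bounded_at p" "q = 3 ^ (p - 2)" "q \<ge> 3" "c = 3 * q"
        note SM = S[unfolded p(1)] M[unfolded p(1)]
        have "card A \<le> 2 * q + 3" "card B \<le> 2 * q + 3"
          using near_card_ge(1)[OF p(2,3) SM(2,5) t Bk nB]
            near_card_ge(1)[OF p(2,3) SM(1,4) tp(2) True nA] p(4) by simp_all
        then show ?thesis using Ki Gb p(5,6) by (intro conjI impI disjI1) linarith+
      qed
    qed
  qed
  have "ind (K j) = 0" using Kj by (simp add: ind_def)
  then show "card X + ind (K i) + ind (K j) + ind (K k) \<le> 3 * 3 ^ (m - 2) + 3"
    using main card by (simp add: c_def)
  show "card X < 3 * 3 ^ (m - 2) + 3 \<or>
        card (slice i X) = 3 ^ (m - 2) + 1 \<and> card (slice j X) = 3 ^ (m - 2) + 1 \<and> card (slice k X) = 3 ^ (m - 2) + 1"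
    if "m \<ge> 3"
    using main card that by (simp add: c_def A_def B_def G_def)
qed

section \<open>Assembling the three parts\<close>

lemma sum_triple: "triple i j k \<Longrightarrow> f i + f j + f k = f 0 + f 1 + (f 2 :: nat)"
proof -
  have "\<forall>i j k. triple i j k \<longrightarrow> f i + f j + f k = f 0 + f 1 + f 2"
    unfolding all_triple by simp
  then show "triple i j k \<Longrightarrow> f i + f j + f k = f 0 + f 1 + f 2" by blast
qed

lemma pair_offender:
  assumes m: "m \<ge> 2" "bounded_at m" "m \<ge> 3 \<Longrightarrow> bounded_at (m - 1)"
    and X: "X \<subseteq> SV (Suc m)" "mv (Suc m) X" and t: "triple i j k"
    and off: "\<not> open_to (slice i X) j"
  shows "card (slice j X) \<le> 3 ^ (m - 2) + 1"
proof -
  obtain s where s: "s \<in> slice i X" "\<not> sees (slice i X) j s" using off by (auto simp: open_to_def)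
  note h = hidden_corner[OF X(2,1) t s]
  show ?thesis
    by (rule near_card[OF m(1,3) slice_SV[OF X(1)] mv_slice_triple(2)[OF X(2) t] t h(1)])
      (use h(3) in auto)
qed

text \<open>Either each part sees the corner facing the other, giving (c+2) + (c+2) with c =
  3^(m-2), or a hidden corner lowers the part it faces to c+1, giving (c+3) + (c+1) at
  worst.\<close>

lemma two_copies:
  assumes m: "m \<ge> 2" "bounded_at m" "m \<ge> 3 \<Longrightarrow> bounded_at (m - 1)"
    and X: "X \<subseteq> SV (Suc m)" "mv (Suc m) X" and t: "triple i j k"
  shows "card (slice i X) + card (slice j X) \<le> 2 * 3 ^ (m - 2) + 4"
proof -
  note tp = triple_perm[OF t]
  note bi = bounded_atD[OF m(2) slice_SV[OF X(1)] mv_slice_triple(1)[OF X(2) t]]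
  note bj = bounded_atD[OF m(2) slice_SV[OF X(1)] mv_slice_triple(2)[OF X(2) t]]
  show ?thesis
  proof (cases "open_to (slice i X) j \<and> open_to (slice j X) i")
    case True
    then show ?thesis using bi(2)[OF tp(1)] bj(2)[OF tp(3)] by simp
  next
    case False
    then show ?thesis
      using pair_offender[OF m X t] pair_offender[OF m X tp(2)] bi(1)[OF t] bj(1)[OF t] by auto
  qed
qed

text \<open>\<open>K\<close> marks the corners required to stay visible, so one statement serves all
  clauses of \<open>bounded_at\<close>. With an empty copy about 2c+4 is reached at most, below 3c+3
  once c > 1; so for m >= 3 equality needs three inhabited copies.\<close>

lemma slices_bound:
  assumes m: "m \<ge> 2" "bounded_at m" "m \<ge> 3 \<Longrightarrow> bounded_at (m - 1)"
    and X: "X \<subseteq> SV (Suc m)" "mv (Suc m) X"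
    and K: "\<And>a. a < 3 \<Longrightarrow> K a \<Longrightarrow> open_to X a"
    and sides: "K 0 \<Longrightarrow> K 1 \<Longrightarrow> K 2 \<Longrightarrow>
      \<exists>a b c. triple a b c \<and> side a b (Suc m) \<inter> X = {} \<and> side a c (Suc m) \<inter> X = {}"
  shows "card X + (ind (K 0) + ind (K 1) + ind (K 2)) \<le> 3 * 3 ^ (m - 2) + 3 \<and>
    (m \<ge> 3 \<longrightarrow> card X < 3 * 3 ^ (m - 2) + 3 \<or> (\<forall>a<3. card (slice a X) = 3 ^ (m - 2) + 1))"
proof -
  define c :: nat where "c = 3 ^ (m - 2)"
  have c1: "c \<ge> 1" by (simp add: c_def)
  have c3: "c \<ge> 3" if "m \<ge> 3"
    using that self_le_power[of "3::nat" "m - 2"] by (simp add: c_def)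
  have i1: "ind b \<le> 1" for b by (simp add: ind_def)
  note o = open_to_slice[OF X(1)]
  let ?goal = "card X + (ind (K 0) + ind (K 1) + ind (K 2)) \<le> 3 * c + 3 \<and>
    (m \<ge> 3 \<longrightarrow> card X < 3 * c + 3 \<or> (\<forall>a<3. card (slice a X) = c + 1))"
  have goalI: ?goal
    if "triple i j k" "card X + ind (K i) + ind (K j) + ind (K k) \<le> 3 * c + 3"
      "m \<ge> 3 \<Longrightarrow> card X < 3 * c + 3 \<or> card (slice i X) = c + 1 \<and> card (slice j X) = c + 1 \<and> card (slice k X) = c + 1"
    for i j k
    using that sum_triple[OF that(1), of "\<lambda>a. ind (K a)"] triple_less[OF that(1)] by auto
  consider (off) i j k where "triple i j k" "\<not> open_to (slice i X) j" "slice j X \<noteq> {}"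
    | (no) "\<And>i j k. triple i j k \<Longrightarrow> slice j X \<noteq> {} \<Longrightarrow> open_to (slice i X) j"
    by blast
  then have ?goal
  proof cases
    case off
    note t = off(1)
    obtain s where s: "s \<in> slice i X" "\<not> sees (slice i X) j s" using off by (auto simp: open_to_def)
    show ?thesis
    proof (cases "slice k X = {}")
      case False
      show ?thesis
        using offender_step[OF m X t s off(3) False K] unfolding c_def[symmetric] by (intro goalI[OF t]) auto
    next
      case True
      have "card (slice i X) + ind (K i) + ind False + ind (K k) \<le> 3 ^ (m - 2) + 3"
        by (rule bounded_flags[OF m(2) slice_SV[OF X(1)] mv_slice_triple(1)[OF X(2) t] t])
          (use K o t in \<open>auto simp: triple_def\<close>)
      moreover have "card (slice j X) \<le> c + 1" using pair_offender[OF m X t off(2)] by (simp add: c_def)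
      moreover have "ind (K j) = 0" using K o off(2) t by (auto simp: triple_def ind_def)
      moreover have "card X = card (slice i X) + card (slice j X)"
        using card_eq_sum_slice[OF t X(1)] True by simp
      ultimately show ?thesis
        using c1 c3 unfolding c_def[symmetric] by (intro goalI[OF t]) (auto simp: ind_def)
    qed
  next
    case no
    show ?thesis
    proof (cases "\<forall>a<3. slice a X \<noteq> {}")
      case True
      have "card (slice i X) + ind (K i) \<le> c + 1" if t: "triple i j k" for i j k
      proof -
        note tp = triple_perm[OF t]
        have ne: "slice i X \<noteq> {}" "slice j X \<noteq> {}" "slice k X \<noteq> {}" and d: "i < 3" "i \<noteq> j" "i \<noteq> k"
          using True t by (auto simp: triple_def)
        have "card (slice i X) + ind (K i) + ind True + ind True \<le> 3 ^ (m - 2) + 3"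
        proof (rule bounded_flags[OF m(2) slice_SV[OF X(1)] mv_slice_triple(1)[OF X(2) t] t])
          \<comment> \<open>Vertices of the other two copies reach corner \<open>i\<close> of the
            whole graph along exactly these two sides of copy \<open>i\<close>.\<close>
          show "side i j m \<inter> slice i X = {} \<and> side i k m \<inter> slice i X = {}" if "K i"
            using open_to_side[OF X(1) K[OF d(1) that] ne(2)] open_to_side[OF X(1) K[OF d(1) that] ne(3)] d
            by (simp add: side_commute)
        qed (use K o d no[OF t] no[OF tp(1)] ne in auto)
        then show ?thesis by (simp add: ind_def c_def)
      qed
      note q = this
      have t: "triple 0 1 2" by (simp add: triple_def)
      note tp = triple_perm[OF t]
      show ?thesis
        by (rule goalI[OF t]) (use q[OF t] q[OF tp(2)] q[OF tp(4)] card_eq_sum_slice[OF t X(1)] in linarith)+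
    next
      case False
      then obtain k where k: "k < 3" "slice k X = {}" by blast
      then obtain i j where t: "triple i j k"
      proof -
        consider "k = 0" | "k = 1" | "k = 2" using k by linarith
        then show ?thesis by cases (use that[of 1 2] that[of 0 2] that[of 0 1] in \<open>auto simp: triple_def\<close>)
      qed
      note tp = triple_perm[OF t]
      have d: "i < 3" "j < 3" "i \<noteq> j" using t by (auto simp: triple_def)
      have X': "card X = card (slice i X) + card (slice j X)"
        using card_eq_sum_slice[OF t X(1)] k by simp
      have single: ?goal if "triple a b k" "slice b X = {}" "card X = card (slice a X)" for a b
      proof -
        have "card (slice a X) + ind (K a) + ind (K b) + ind False \<le> 3 ^ (m - 2) + 3"
          by (rule bounded_flags[OF m(2) slice_SV[OF X(1)] mv_slice_triple(1)[OF X(2) that(1)] that(1)])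
            (use K o that in \<open>auto simp: triple_def\<close>)
        then show ?thesis
          using that(3) c1 c3 i1[of "K k"] unfolding c_def[symmetric]
          by (intro goalI[OF that(1)]) (auto simp: ind_def)
      qed
      consider "slice i X = {}" | "slice j X = {}" | "slice i X \<noteq> {}" "slice j X \<noteq> {}" by blast
      then show ?thesis
      proof cases
        case 1
        then show ?thesis using single[OF tp(2)] X' by simp
      next
        case 2
        then show ?thesis using single[OF t] X' by simp
      next
        case 3
        have Ai: "open_to (slice i X) j" and Bj: "open_to (slice j X) i"
          using no[OF t 3(2)] no[OF tp(2) 3(1)] by auto
        have A: "card (slice i X) + ind (K i \<or> K k) \<le> c + 2"
        proof -
          \<comment> \<open>Raising all three flags would require clear sides, so besides the gate
            \<open>j\<close> at most one of \<open>i\<close> and \<open>k\<close> is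
            claimed.\<close>
          have "card (slice i X) + ind (K i \<and> \<not> K k) + ind True + ind (K k) \<le> 3 ^ (m - 2) + 3"
            by (rule bounded_flags[OF m(2) slice_SV[OF X(1)] mv_slice_triple(1)[OF X(2) t] t])
              (use K o d k Ai in auto)
          then show ?thesis by (auto simp: ind_def c_def split: if_splits)
        qed
        have B: "card (slice j X) + ind (K j \<or> K k) \<le> c + 2"
        proof -
          have "card (slice j X) + ind True + ind (K j \<and> \<not> K k) + ind (K k) \<le> 3 ^ (m - 2) + 3"
            by (rule bounded_flags[OF m(2) slice_SV[OF X(1)] mv_slice_triple(2)[OF X(2) t] t])
              (use K o d k Bj in auto)
          then show ?thesis by (auto simp: ind_def c_def split: if_splits)
        qed
        show ?thesis
        proof (cases "K i \<and> K j \<and> K k")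
          case False
          \<comment> \<open>The two parts can pay for up to two required corners; only three of them
            need the clear sides.\<close>
          then have "ind (K i) + ind (K j) + ind (K k) \<le> ind (K i \<or> K k) + ind (K j \<or> K k)"
            by (auto simp: ind_def)
          then show ?thesis
            using A B X' c1 c3 by (intro goalI[OF t]) linarith+
        next
          case all: True
          then have Ka: "K a" if "a < 3" for a using triple_less[OF t] that by auto
          then have op: "open_to (slice b X) a" if "a < 3" for a b using K o that by blast
          obtain a b e where abe: "triple a b e" "side a b (Suc m) \<inter> X = {}" "side a e (Suc m) \<inter> X = {}"
            using sides Ka[of 0] Ka[of 1] Ka[of 2] by auto
          have small: "card (slice x X) \<le> c"
            if "triple x y z" "side x y m \<inter> slice x X = {}" "side x z m \<inter> slice x X = {}" for x y z
            using bounded_atD(4)[OF m(2) slice_SV[OF X(1)] mv_slice_triple(1)[OF X(2) that(1)] that(1)] op that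
            by (auto simp: triple_def c_def)
          have ij: "side i j m \<inter> slice j X = {}" "side j i m \<inter> slice i X = {}"
            using open_to_side[OF X(1) K 3(1)] open_to_side[OF X(1) K 3(2)] Ka d by auto
          \<comment> \<open>The two clear sides of \<open>X\<close> meet at corner \<open>a\<close>.
            If copy \<open>a\<close> is inhabited, they are clear in it. Otherwise
            \<open>a = k\<close>: in copy \<open>i\<close> the side from \<open>k\<close> is still
            clear, and the one between \<open>i\<close> and \<open>j\<close> is clear because copy
            \<open>j\<close> is inhabited and \<open>X\<close> is open to \<open>i\<close>.\<close>
          have "card (slice i X) \<le> c \<or> card (slice j X) \<le> c"
          proof (cases "a = k")
            case False
            then have "a = i \<or> a = j" using abe(1) triple_less[OF t, of a] by (auto simp: triple_def)
            moreover have "card (slice a X) \<le> c"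
              using small[OF abe(1)] slice_side[OF abe(2), of a] slice_side[OF abe(3), of a] by simp
            ultimately show ?thesis by blast
          next
            case True
            then have "b = i \<or> e = i" using abe(1) t triple_less[OF abe(1), of i] by (auto simp: triple_def)
            then have "side k i m \<inter> slice i X = {}"
              using slice_side[OF abe(2), of i] slice_side[OF abe(3), of i] True by auto
            then have "card (slice i X) \<le> c"
              using small[OF t] ij by (simp add: side_commute)
            then show ?thesis by blast
          qed
          then show ?thesis
            using A B X' c1 c3 all i1 by (intro goalI[OF t]) (auto simp: ind_def)
        qed
      qed
    qed
  qed
  then show ?thesis by (simp add: c_def)
qed

text \<open>The four clauses are \<open>slices_bound\<close> with \<open>K\<close> holding for no
  corner, one corner, all but one, and all.\<close>

lemma bounded_at_Suc:
  assumes m: "m \<ge> 2" "bounded_at m" "m \<ge> 3 \<Longrightarrow> bounded_at (m - 1)"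
  shows "bounded_at (Suc m)"
proof -
  have c: "3 ^ (Suc m - 2) = 3 * (3::nat) ^ (m - 2)"
    using m(1) by (metis Suc_diff_le power_Suc)
  show ?thesis
    unfolding bounded_at_def c
  proof (intro allI impI conjI)
    fix X i j k
    assume X: "X \<subseteq> SV (Suc m)" "mv (Suc m) X" and t: "triple i j k"
    note d = t[unfolded triple_def]
    note st = slices_bound[OF m X]
    have s: "ind (K 0) + ind (K 1) + ind (K 2) = ind (K i) + ind (K j) + ind (K k)" for K
      using sum_triple[OF t, of "\<lambda>a. ind (K a)"] by simp
    show "card X \<le> 3 * 3 ^ (m - 2) + 3"
    proof -
      have "card X + (ind False + ind False + ind False) \<le> 3 * 3 ^ (m - 2) + 3"
        by (rule st[THEN conjunct1]) simp_all
      then show ?thesis by (simp add: ind_def)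
    qed
    show "card X \<le> 3 * 3 ^ (m - 2) + 2" if "open_to X k"
    proof -
      have "card X + (ind (0 = k) + ind (1 = k) + ind (2 = k)) \<le> 3 * 3 ^ (m - 2) + 3"
        by (rule st[THEN conjunct1]) (use that d in auto)
      then show ?thesis using s[of "\<lambda>a. a = k"] d by (simp add: ind_def)
    qed
    show "card X \<le> 3 * 3 ^ (m - 2) + 1" if "open_to X j" "open_to X k"
    proof -
      have "card X + (ind (0 \<noteq> i) + ind (1 \<noteq> i) + ind (2 \<noteq> i)) \<le> 3 * 3 ^ (m - 2) + 3"
        by (rule st[THEN conjunct1]) (use that d triple_less[OF t] in auto)
      then show ?thesis using s[of "\<lambda>a. a \<noteq> i"] d by (simp add: ind_def)
    qed
    show "card X \<le> 3 * 3 ^ (m - 2)"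
      if "open_to X i" "open_to X j" "open_to X k" "side i j (Suc m) \<inter> X = {}" "side i k (Suc m) \<inter> X = {}"
    proof -
      have "card X + (ind True + ind True + ind True) \<le> 3 * 3 ^ (m - 2) + 3"
        by (rule st[THEN conjunct1]) (use that t triple_less[OF t] in auto)
      then show ?thesis by (simp add: ind_def)
    qed
  qed
qed

text \<open>Two consecutive orders are carried along, because a near part is estimated through its
  own subcopies.\<close>

lemma bounded_at: "n \<ge> 2 \<Longrightarrow> bounded_at n \<and> (n \<ge> 3 \<longrightarrow> bounded_at (n - 1))"
proof (induction n rule: dec_induct)
  case base
  then show ?case using bounded_at_2 by simp
next
  case (step n)
  then show ?case using bounded_at_Suc by simp
qed

section \<open>From parts of words to copies of the graph, and the theorem\<close>

lemma card_copy:
  assumes "X \<subseteq> SV (Suc m)" "i < 3"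
  shows "X \<inter> sierp_copy 3 (Suc m) i = Cons i ` slice i X"
proof (intro set_eqI iffI)
  fix v assume v: "v \<in> X \<inter> sierp_copy 3 (Suc m) i"
  then obtain a s where "v = a # s" using assms SV_SucE by blast
  then show "v \<in> Cons i ` slice i X" using v by (auto simp: sierp_copy_def)
next
  fix v assume "v \<in> Cons i ` slice i X"
  then obtain s where "v = i # s" "i # s \<in> X" by auto
  then show "v \<in> X \<inter> sierp_copy 3 (Suc m) i"
    using subsetD[OF assms(1), of "i # s"] by (simp add: sierp_copy_def del: SV_Cons)
qed

theorem theorem4p4:
  shows "(\<forall>n::nat. n \<ge> 2 \<longrightarrow> mu (sierp_V 3 n) (sierp_E 3 n) = 3 ^ (n - 2) + 3)
    \<and> (\<forall>n::nat. n \<ge> 4 \<longrightarrow>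
         (\<forall>X. mutual_visibility_set (sierp_V 3 n) (sierp_E 3 n) X \<and> card X = 3 ^ (n - 2) + 3
              \<longrightarrow> (\<forall>i<3. card (X \<inter> sierp_copy 3 n i) = 3 ^ (n - 3) + 1))
       \<and> (\<forall>X. mutual_visibility_set (sierp_V 3 n) (sierp_E 3 n) X
              \<longrightarrow> (\<forall>i<3. \<forall>j<3. i \<noteq> j \<longrightarrow>
                    card (X \<inter> (sierp_copy 3 n i \<union> sierp_copy 3 n j)) \<le> 2 * 3 ^ (n - 3) + 4)))"
proof (intro conjI allI impI)
  fix n :: nat
  assume n: "n \<ge> 2"
  let ?S = "{card X | X. mutual_visibility_set (SV n) (SE n) X}"
  have le: "y \<le> 3 ^ (n - 2) + 3" if y: "y \<in> ?S" for y
  proof -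
    obtain X where X: "y = card X" "X \<subseteq> SV n" "mv n X"
      using y by (auto simp: mutual_visibility_set_iff_mv)
    have "triple 0 1 2" by (simp add: triple_def)
    then show ?thesis
      using bounded_atD(1)[OF conjunct1[OF bounded_at[OF n]] X(2,3)] X(1) by simp
  qed
  then have fin: "finite ?S" by (meson finite_nat_set_iff_bounded_le)
  obtain X where "mutual_visibility_set (SV n) (SE n) X" "card X = 3 ^ (n - 2) + 3"
    using mutual_visibility_lower[OF n] by blast
  then have "3 ^ (n - 2) + 3 \<in> ?S" by (metis (mono_tags, lifting) mem_Collect_eq)
  then show "mu (SV n) (SE n) = 3 ^ (n - 2) + 3"
    unfolding mu_def by (intro Max_eqI[OF fin] le)
next
  fix n :: nat and X and i :: nat
  assume n: "n \<ge> 4" and "mutual_visibility_set (SV n) (SE n) X \<and> card X = 3 ^ (n - 2) + 3" and i: "i < 3"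
  then obtain m where m: "n = Suc m" "m \<ge> 3" and X: "X \<subseteq> SV (Suc m)" "mv (Suc m) X"
    and c: "card X = 3 ^ (m - 1) + 3"
    by (cases n) (auto simp: mutual_visibility_set_iff_mv simp del: mv.simps)
  have c': "3 ^ (m - 1) = 3 * (3::nat) ^ (m - 2)"
    using m(2) power_Suc[of "3::nat" "m - 2"] by (simp add: Suc_diff_Suc numeral_2_eq_2)
  have "card (slice i X) = 3 ^ (m - 2) + 1"
  proof -
    \<comment> \<open>No corner is required here. The strict alternative contradicts the assumed
      size, and \<open>m \<ge> 3\<close> is the hypothesis \<open>n \<ge> 4\<close>.\<close>
    have "card X < 3 * 3 ^ (m - 2) + 3 \<or> (\<forall>a<3. card (slice a X) = 3 ^ (m - 2) + 1)"
      by (rule slices_bound[of m X "\<lambda>_. False", THEN conjunct2, THEN mp])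
        (use bounded_at[of m] m X in auto)
    then show ?thesis using c c' i by simp
  qed
  moreover have "n - 3 = m - 2" using m by simp
  ultimately show "card (X \<inter> sierp_copy 3 n i) = 3 ^ (n - 3) + 1"
    using card_copy[OF X(1) i] m by (simp add: card_image)
next
  fix n :: nat and X and i j :: nat
  assume n: "n \<ge> 4" and "mutual_visibility_set (SV n) (SE n) X" and i: "i < 3" "j < 3" "i \<noteq> j"
  then obtain m where m: "n = Suc m" "m \<ge> 3" and X: "X \<subseteq> SV (Suc m)" "mv (Suc m) X"
    by (cases n) (auto simp: mutual_visibility_set_iff_mv simp del: mv.simps)
  obtain k where t: "triple i j k" using triple_ex i by blast
  have "card (X \<inter> (sierp_copy 3 n i \<union> sierp_copy 3 n j)) \<le> card (Cons i ` slice i X) + card (Cons j ` slice j X)"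
    unfolding Int_Un_distrib m(1) card_copy[OF X(1) i(1)] card_copy[OF X(1) i(2)] by (rule card_Un_le)
  also have "\<dots> = card (slice i X) + card (slice j X)" by (simp add: card_image)
  also have "\<dots> \<le> 2 * 3 ^ (m - 2) + 4"
    using two_copies[OF _ _ _ X t] bounded_at[of m] m by simp
  finally have "card (X \<inter> (sierp_copy 3 n i \<union> sierp_copy 3 n j)) \<le> 2 * 3 ^ (m - 2) + 4" .
  moreover have "n - 3 = m - 2" using m by simp
  ultimately show "card (X \<inter> (sierp_copy 3 n i \<union> sierp_copy 3 n j)) \<le> 2 * 3 ^ (n - 3) + 4"
    by simp
qed

end
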